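(* Let $G=(V,E)$ be an infinite connected graph with all degrees bounded by $\Delta<\infty$, which is non-amenable (i.e. $\kappa_V(G)>0$) and satisfies $\inf_{x\in V}P_x[\tilde H_x=\infty]>0$. Then \[ u_c(G)\ \ge\ \frac{1}{2\Delta^2}\left(\frac{1}{\rho}-1\right). \]
   Context: Setting: $G=(V,E)$ is an infinite, connected, locally finite graph; $d_x$ is the degree of $x$, $d(\cdot,\cdot)$ the graph distance. $P_x$ is the law of simple random walk $(X_n)_{n\ge0}$ on $G$ started at $x$, and $p^{(n)}(x,y)=P_x[X_n=y]$. For $K\subset V$, $\tilde H_K=\inf\{n\ge1: X_n\in K\}$ and $\tilde H_x=\tilde H_{\{x\}}$. The spectral radius is $\rho=\limsup_{n\to\infty}p^{(n)}(x,y)^{1/n}$ (independent of $x,y$). The outer vertex boundary of $K$ is $\partial_VK=\{y\notin K:\exists x\in K,\ d(x,y)=1\}$ and $\kappa_V(G)=\inf\{|\partial_VK|/|K|: 0<|K|<\infty\}$; $G$ is non-amenable if $\kappa_V>0$. Random interlacements (on a graph where simple random walk is transient): for finite $K\subset V$ let $e_K(x)=1_{\{x\in K\}}d_xP_x[\tilde H_K=\infty]$ and $\mathrm{cap}(K)=\sum_xe_K(x)$. Let $W$ be the set of doubly infinite nearest-neighbour paths $w:\mathbb Z\to V$ visiting each vertex finitely often, $W^*$ the quotient of $W$ by time shifts, $\pi^*:W\to W^*$ the projection, and $W^*_K$ the set of classes of paths hitting $K$. There is a unique $\sigma$-finite measure $\nu$ on $W^*$ such that for every finite $K$, $1_{W^*_K}\nu=\pi^*\circ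 Q_K$, where $Q_K[(X_{-n})_{n\ge0}\in A,\,X_0=x,\,(X_n)_{n\ge0}\in B]=P_x[A\mid\tilde H_K=\infty]\,e_K(x)\,P_x[B]$. Under $\mathbb P_u$, $\omega$ is a Poisson point process on $W^*$ with intensity $u\nu$; the interlacement set $\mathcal I$ is the union of the ranges of the trajectories in its support (equivalently $\mathcal I$ is the random subset with $\mathbb P_u[\mathcal I\cap K=\emptyset]=e^{-u\,\mathrm{cap}(K)}$ for all finite $K$). $\mathcal I$ is called connected if the subgraph of $G$ induced by $\mathcal I$ is connected, and $u_c(G)=\inf\{u:\mathcal I\text{ is connected }\mathbb P_u\text{-a.s.}\}$. *)

theory Defs
  imports "HOL-Probability.Probability"
begin

text \<open>Graphs: vertex set V and symmetric, irreflexive adjacency relation E with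
  E x y implying x, y in V.\<close>

definition graph :: "'a set \<Rightarrow> ('a \<Rightarrow> 'a \<Rightarrow> bool) \<Rightarrow> bool" where
  "graph V E \<longleftrightarrow> (\<forall>x y. E x y \<longrightarrow> x \<in> V \<and> y \<in> V \<and> E y x \<and> x \<noteq> y)"

definition deg :: "('a \<Rightarrow> 'a \<Rightarrow> bool) \<Rightarrow> 'a \<Rightarrow> nat" where
  "deg E x = card {y. E x y}"

definition locally_finite :: "'a set \<Rightarrow> ('a \<Rightarrow> 'a \<Rightarrow> bool) \<Rightarrow> bool" where
  "locally_finite V E \<longleftrightarrow> (\<forall>x\<in>V. finite {y. E x y})"

text \<open>Connectedness of the subgraph induced by a vertex set S.\<close>
definition induced_connected :: "('a \<Rightarrow> 'a \<Rightarrow> bool) \<Rightarrow> 'a set \<Rightarrow> bool" where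
  "induced_connected E S \<longleftrightarrow>
     (\<forall>x\<in>S. \<forall>y\<in>S. (x, y) \<in> {(a, b). a \<in> S \<and> b \<in> S \<and> E a b}\<^sup>*)"

text \<open>n-step transition probabilities p^(n)(x,y) of simple random walk.\<close>
fun trans_pow :: "('a \<Rightarrow> 'a \<Rightarrow> bool) \<Rightarrow> nat \<Rightarrow> 'a \<Rightarrow> 'a \<Rightarrow> real" where
  "trans_pow E 0 x y = (if x = y then 1 else 0)"
| "trans_pow E (Suc n) x y = (\<Sum>z\<in>{z. E x z}. trans_pow E n z y / real (deg E x))"

text \<open>Spectral radius rho = limsup_n p^(n)(x,y)^(1/n).\<close>
definition spectral_radius :: "('a \<Rightarrow> 'a \<Rightarrow> bool) \<Rightarrow> 'a \<Rightarrow> 'a \<Rightarrow> real" where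
  "spectral_radius E x y = real_of_ereal (limsup (\<lambda>n. ereal (root n (trans_pow E n x y))))"

text \<open>hit_prob E K n x = P_x[1 \<le> tilde H_K \<le> n].\<close>
fun hit_prob :: "('a \<Rightarrow> 'a \<Rightarrow> bool) \<Rightarrow> 'a set \<Rightarrow> nat \<Rightarrow> 'a \<Rightarrow> real" where
  "hit_prob E K 0 x = 0"
| "hit_prob E K (Suc n) x =
     (\<Sum>y\<in>{y. E x y}. (if y \<in> K then 1 else hit_prob E K n y) / real (deg E x))"

text \<open>escape_prob E K x = P_x[tilde H_K = \<infinity>] = 1 - P_x[\<Union>n. tilde H_K \<le> n].\<close>
definition escape_prob :: "('a \<Rightarrow> 'a \<Rightarrow> bool) \<Rightarrow> 'a set \<Rightarrow> 'a \<Rightarrow> real" where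
  "escape_prob E K x = 1 - (SUP n. hit_prob E K n x)"

text \<open>Capacity cap(K) = sum_x e_K(x), e_K(x) = 1_K(x) d_x P_x[tilde H_K = \<infinity>].\<close>
definition cap :: "('a \<Rightarrow> 'a \<Rightarrow> bool) \<Rightarrow> 'a set \<Rightarrow> real" where
  "cap E K = (\<Sum>x\<in>K. real (deg E x) * escape_prob E K x)"

text \<open>Outer vertex boundary and vertex isoperimetric constant.\<close>
definition vertex_boundary :: "'a set \<Rightarrow> ('a \<Rightarrow> 'a \<Rightarrow> bool) \<Rightarrow> 'a set \<Rightarrow> 'a set" where
  "vertex_boundary V E K = {y \<in> V. y \<notin> K \<and> (\<exists>x\<in>K. E x y)}"

definition kappa_V :: "'a set \<Rightarrow> ('a \<Rightarrow> 'a \<Rightarrow> bool) \<Rightarrow> real" where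
  "kappa_V V E = Inf {real (card (vertex_boundary V E K)) / real (card K) | K.
                        K \<subseteq> V \<and> finite K \<and> K \<noteq> {}}"

text \<open>Measurable space of random subsets of V (product sigma-algebra).\<close>
definition subset_space :: "'a set \<Rightarrow> 'a set measure" where
  "subset_space V = sigma (Pow V) {{S \<in> Pow V. x \<in> S} | x. x \<in> V}"

text \<open>M is the law of the interlacement set at level u: characterised by
  P[I \<inter> K = {}] = exp(-u cap K) for all finite K.\<close>
definition interlacement_law ::
    "'a set \<Rightarrow> ('a \<Rightarrow> 'a \<Rightarrow> bool) \<Rightarrow> real \<Rightarrow> 'a set measure \<Rightarrow> bool" where
  "interlacement_law V E u M \<longleftrightarrow>
     prob_space M \<and> sets M = sets (subset_space V) \<and>
     (\<forall>K. K \<subseteq> V \<longrightarrow> finite K \<longrightarrow>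
        measure M {S \<in> space M. S \<inter> K = {}} = exp (- u * cap E K))"

text \<open>u_c = inf {u > 0. I connected P_u-a.s.} (as an extended real; inf of empty set = \<infinity>).\<close>
definition u_c :: "'a set \<Rightarrow> ('a \<Rightarrow> 'a \<Rightarrow> bool) \<Rightarrow> ereal" where
  "u_c V E = Inf (ereal ` {u. 0 < u \<and>
      (\<forall>M. interlacement_law V E u M \<longrightarrow> (AE S in M. induced_connected E S))})"

end

(*
  The trajectories of the interlacement at level 1 that meet both a and b have mass
  cap{a} + cap{b} - cap{a,b} <= 2 deg(a) g(a,b), where g is the Green function.  Two connected
  vertices of the interlacement set are joined by a chain of distinct trajectories, consecutive ones
  being linked by an edge, so the expected number of chains is bounded by iterating 2u deg g and the
  adjacency operator deg P.  With beta = 1 + 2 u Delta^2 these iterates sum up to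
  2 u Delta sum_n beta^n p^n(x,y), because 1 + c P/(1-P) + (c P/(1-P))^2 + ... = (1-P)/(1-(1+c)P).
  If beta rho < 1 this is finite and tends to 0 as y goes to infinity, whereas x and y both belong to
  the interlacement set with probability bounded below, since the escape probabilities are.

  Only finite-dimensional laws are used.  On a finite set F the capacity of K is the mass of the sets
  A meeting K under a measure nu on subsets of F (the traces of the trajectories on F), obtained as a
  limit of time averages of stationary finite walks.  The trace of the interlacement on F is then the
  union of independently chosen sets A, each present with probability 1 - exp(-u nu(A)).
*)
theory Submission
  imports Defs
begin

section \<open>Random unions of sets\<close>

text \<open>Avoiding \<open>F - B\<close> means lying inside \<open>B\<close>, so the avoidance
  probabilities are the sums of the masses over \<open>Pow B\<close>. Induction on \<open>B\<close>
  then isolates the mass of \<open>B\<close> itself.\<close>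

lemma pmf_eqI_avoidance:
  assumes F: "finite F" and p: "set_pmf p \<subseteq> Pow F" and q: "set_pmf q \<subseteq> Pow F"
    and eq: "\<And>K. K \<subseteq> F \<Longrightarrow>
      measure_pmf.prob p {S. S \<inter> K = {}} = measure_pmf.prob q {S. S \<inter> K = {}}"
  shows "p = q"
proof -
  have sum: "measure_pmf.prob r {S. S \<inter> (F - B) = {}} = (\<Sum>A\<in>Pow B. pmf r A)"
    if "set_pmf r \<subseteq> Pow F" "B \<subseteq> F" for r B
  proof -
    have "measure_pmf.prob r {S. S \<inter> (F - B) = {}} = measure_pmf.prob r (Pow B)"
      using that by (intro measure_prob_cong_0) (auto simp: pmf_eq_0_set_pmf)
    also have "\<dots> = (\<Sum>A\<in>Pow B. pmf r A)"
      using F that by (intro measure_measure_pmf_finite) (auto dest: finite_subset)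
    finally show ?thesis .
  qed
  have eqF: "pmf p B = pmf q B" if "B \<subseteq> F" for B
    using finite_subset[OF that F] that
  proof (induction B rule: finite_psubset_induct)
    case (psubset B)
    have "finite {A. A \<subset> B}"
      using psubset.hyps by (auto intro: finite_subset[of _ "Pow B"])
    moreover have "Pow B = insert B {A. A \<subset> B}" by auto
    ultimately have "(\<Sum>A\<in>Pow B. pmf r A) = pmf r B + (\<Sum>A | A \<subset> B. pmf r A)" for r :: "'a set pmf"
      by simp
    moreover have "(\<Sum>A\<in>Pow B. pmf p A) = (\<Sum>A\<in>Pow B. pmf q A)"
      using sum[OF p psubset.prems] sum[OF q psubset.prems] eq[of "F - B"] by simp
    moreover have "(\<Sum>A | A \<subset> B. pmf p A) = (\<Sum>A | A \<subset> B. pmf q A)"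
      using psubset by (intro sum.cong refl psubset.IH) auto
    ultimately show ?case by simp
  qed
  show ?thesis
  proof (rule pmf_eqI)
    fix B
    show "pmf p B = pmf q B"
    proof (cases "B \<subseteq> F")
      case False
      then have "pmf p B = 0" "pmf q B = 0" using p q by (auto simp: pmf_eq_0_set_pmf)
      then show ?thesis by simp
    qed (rule eqF)
  qed
qed

lemma prob_pair_pmf_Times:
  "measure_pmf.prob (pair_pmf p q) (A \<times> B) = measure_pmf.prob p A * measure_pmf.prob q B"
proof -
  have "measure_pmf.prob (pair_pmf p q) (A \<times> B)
      = measure_pmf.prob (pair_pmf p q) ((A \<times> B) \<inter> set_pmf (pair_pmf p q))"
    by (rule measure_Int_set_pmf[symmetric])
  \<comment> \<open>Cutting down to the supports makes both sets countable, as the product rule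
    below requires.\<close>
  also have "(A \<times> B) \<inter> set_pmf (pair_pmf p q) = (A \<inter> set_pmf p) \<times> (B \<inter> set_pmf q)"
    by auto
  also have "measure_pmf.prob (pair_pmf p q) \<dots>
      = measure_pmf.prob p (A \<inter> set_pmf p) * measure_pmf.prob q (B \<inter> set_pmf q)"
    by (rule measure_pmf_prob_product) (auto intro: countable_Int2)
  finally show ?thesis by (simp add: measure_Int_set_pmf)
qed

text \<open>A Poisson process of sets on a finite family: only whether the Poisson count of each set is
  positive matters for the union.\<close>

definition open_sets :: "'a set set \<Rightarrow> ('a set \<Rightarrow> real) \<Rightarrow> ('a set \<Rightarrow> bool) pmf" where
  "open_sets \<C> w = Pi_pmf \<C> False (\<lambda>A. bernoulli_pmf (1 - exp (- w A)))"

definition open_union :: "'a set set \<Rightarrow> ('a set \<Rightarrow> real) \<Rightarrow> 'a set pmf" where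
  "open_union \<C> w = map_pmf (\<lambda>c. \<Union>{A\<in>\<C>. c A}) (open_sets \<C> w)"

lemma set_pmf_open_union: "set_pmf (open_union \<C> w) \<subseteq> Pow (\<Union>\<C>)"
  by (auto simp: open_union_def)

lemma prob_bernoulli_exp:
  assumes "0 \<le> (w::real)"
  shows "measure_pmf.prob (bernoulli_pmf (1 - exp (- w))) {False} = exp (- w)"
    "measure_pmf.prob (bernoulli_pmf (1 - exp (- w))) {True} = 1 - exp (- w)"
  using assms by (simp_all add: measure_pmf_single)

text \<open>The union misses \<open>K\<close> exactly when every set meeting \<open>K\<close> is
  closed, and the states of the sets are independent.\<close>

lemma prob_open_union_avoid:
  assumes "finite \<C>" and w: "\<And>A. A \<in> \<C> \<Longrightarrow> 0 \<le> w A"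
  shows "measure_pmf.prob (open_union \<C> w) {S. S \<inter> K = {}} = exp (- (\<Sum>A | A \<in> \<C> \<and> A \<inter> K \<noteq> {}. w A))"
proof -
  let ?X = "\<lambda>A. if A \<inter> K = {} then UNIV else {False}"
  have "(\<lambda>c. \<Union>{A\<in>\<C>. c A}) -` {S. S \<inter> K = {}} = Pi \<C> ?X" by (auto simp: Pi_def)
  then have "measure_pmf.prob (open_union \<C> w) {S. S \<inter> K = {}}
      = (\<Prod>A\<in>\<C>. measure_pmf.prob (bernoulli_pmf (1 - exp (- w A))) (?X A))"
    using assms(1) by (simp add: open_union_def open_sets_def measure_Pi_pmf_Pi)
  also have "\<dots> = (\<Prod>A\<in>\<C>. exp (- (if A \<inter> K \<noteq> {} then w A else 0)))"
    by (intro prod.cong refl) (use w prob_bernoulli_exp in auto)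
  also have "\<dots> = exp (- (\<Sum>A\<in>\<C>. if A \<inter> K \<noteq> {} then w A else 0))"
    using assms(1) by (simp add: exp_sum flip: sum_negf)
  finally show ?thesis using assms(1) by (simp add: sum.If_cases Collect_conj_eq)
qed

text \<open>Membership of the end points is required separately, because the reflexive closure
  relates every vertex to itself, even outside \<open>S\<close>.\<close>

definition linked :: "('a \<Rightarrow> 'a \<Rightarrow> bool) \<Rightarrow> 'a set \<Rightarrow> 'a \<Rightarrow> 'a \<Rightarrow> bool" where
  "linked E S x y \<longleftrightarrow> x \<in> S \<and> y \<in> S \<and> (x, y) \<in> {(a, b). a \<in> S \<and> b \<in> S \<and> E a b}\<^sup>*"

lemma linked_mono:
  assumes "linked E S x y" "S \<subseteq> T" shows "linked E T x y"
proof -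
  have "{(a, b). a \<in> S \<and> b \<in> S \<and> E a b}\<^sup>* \<subseteq> {(a, b). a \<in> T \<and> b \<in> T \<and> E a b}\<^sup>*"
    using assms(2) by (intro rtrancl_mono) auto
  then show ?thesis using assms by (auto simp: linked_def)
qed

lemma linked_step:
  assumes "linked E S x y" "z \<in> S" "E y z" shows "linked E S x z"
  using assms by (auto simp: linked_def intro: rtrancl_into_rtrancl)

text \<open>Cut the path at its last visit to \<open>A\<close>.\<close>

lemma linked_last_exit:
  assumes "linked E S x y" and x: "x \<in> A"
  shows "y \<in> A \<or> (\<exists>a\<in>A. \<exists>b. E a b \<and> linked E (S - A) b y)"
proof -
  have "(x, y) \<in> {(a, b). a \<in> S \<and> b \<in> S \<and> E a b}\<^sup>*" using assms by (simp add: linked_def)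
  then show ?thesis
  proof (induction rule: rtrancl_induct)
    case (step y z)
    show ?case
    proof (cases "z \<in> A \<or> y \<in> A")
      case True
      then show ?thesis using step.hyps by (auto simp: linked_def)
    next
      case False
      then obtain a b where ab: "a \<in> A" "E a b" "linked E (S - A) b y" using step.IH by auto
      then have "linked E (S - A) b z" using False step.hyps by (auto intro: linked_step)
      then show ?thesis using ab by blast
    qed
  qed (use x in auto)
qed

text \<open>After its last exit from \<open>A\<close> the path runs in
  \<open>\<Union>\<O> - A\<close>, which the other sets cover. The rest of the chain thus never uses
  \<open>A\<close> again, and this is what makes independence available.\<close>

lemma linked_Union_decompose:
  assumes "linked E (\<Union>\<O>) x y"
  shows "\<exists>A\<in>\<O>. x \<in> A \<and> (y \<in> A \<or> (\<exists>a\<in>A. \<exists>b. E a b \<and> linked E (\<Union>(\<O> - {A})) b y))"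
proof -
  obtain A where A: "A \<in> \<O>" "x \<in> A" using assms by (auto simp: linked_def)
  have "\<Union>\<O> - A \<subseteq> \<Union>(\<O> - {A})" by auto
  then show ?thesis using linked_last_exit[OF assms A(2)] A linked_mono by metis
qed

text \<open>Union bound over the first set \<open>A\<close> of a chain and over the edge by which
  the chain leaves it. The remainder uses only sets other than \<open>A\<close>, so it is
  independent of the state of \<open>A\<close> and lives on a smaller family. Hence the induction
  runs over subfamilies, with one \<open>R\<close> serving them all.\<close>

lemma prob_linked_le:
  fixes E :: "'a \<Rightarrow> 'a \<Rightarrow> bool" and R :: "'a \<Rightarrow> real"
  assumes \<C>: "finite \<C>" "\<And>A. A \<in> \<C> \<Longrightarrow> finite A" and nb: "\<And>a. finite {b. E a b}"
    and w: "\<And>A. A \<in> \<C> \<Longrightarrow> 0 \<le> w A" and R: "\<And>x. 0 \<le> R x"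
    and super: "\<And>x. (\<Sum>A | A \<in> \<C> \<and> x \<in> A.
        w A * (of_bool (y \<in> A) + (\<Sum>a\<in>A. \<Sum>b | E a b. R b))) \<le> R x"
  shows "measure_pmf.prob (open_union \<C> w) {S. linked E S x y} \<le> R x"
proof -
  have "measure_pmf.prob (open_union \<D> w) {S. linked E S x y} \<le> R x"
    if "finite \<D>" "\<D> \<subseteq> \<C>" for \<D>
    using that
  proof (induction \<D> arbitrary: x rule: finite_psubset_induct)
    case (psubset \<D>)
    \<comment> \<open>\<open>A\<close> is open and can begin a chain to \<open>y\<close>; the
      condition that it contains the starting point is put into the index set of the union
      below.\<close>
    define Ev where "Ev A = {c. c A \<and> (y \<in> A \<or> (\<exists>a\<in>A. \<exists>b. E a b \<and>
        linked E (\<Union>{B\<in>\<D> - {A}. c B}) b y))}" for A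
    have Ev: "measure_pmf.prob (open_sets \<D> w) (Ev A)
        \<le> w A * (of_bool (y \<in> A) + (\<Sum>a\<in>A. \<Sum>b | E a b. R b))" if A: "A \<in> \<D>" for A
    proof -
      have AC: "A \<in> \<C>" using A psubset.prems by auto
      let ?D = "\<D> - {A}"
      let ?L = "\<lambda>b. {f. linked E (\<Union>{B\<in>?D. f B}) b y}"
      let ?T = "{f::'a set \<Rightarrow> bool. y \<in> A} \<union> (\<Union>a\<in>A. \<Union>b\<in>{b. E a b}. ?L b)"
      have D: "finite ?D" "A \<notin> ?D" "insert A ?D = \<D>" using psubset.hyps A by auto
      \<comment> \<open>The state of \<open>A\<close> is split off as an independent factor;
        \<open>Ev A\<close> then becomes a product event, with \<open>?T\<close> depending on the
        other sets only.\<close>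
      have "open_sets \<D> w = map_pmf (\<lambda>(t, f). f(A := t))
          (pair_pmf (bernoulli_pmf (1 - exp (- w A))) (open_sets ?D w))"
        unfolding open_sets_def using Pi_pmf_insert[OF D(1,2)] D(3) by simp
      moreover have "(\<lambda>(t, f). f(A := t)) -` Ev A = {True} \<times> ?T"
      proof -
        have "{B \<in> ?D. (f(A := t)) B} = {B \<in> ?D. f B}" for f t by auto
        then show ?thesis by (auto simp: Ev_def) blast+
      qed
      ultimately have "measure_pmf.prob (open_sets \<D> w) (Ev A)
          = (1 - exp (- w A)) * measure_pmf.prob (open_sets ?D w) ?T"
        using w[OF AC] by (simp add: prob_pair_pmf_Times prob_bernoulli_exp)
      also have "\<dots> \<le> w A * (of_bool (y \<in> A) + (\<Sum>a\<in>A. \<Sum>b | E a b. R b))"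
      proof (rule mult_mono)
        show "1 - exp (- w A) \<le> w A" using exp_ge_add_one_self[of "- w A"] by simp
        have "measure_pmf.prob (open_sets ?D w) ?T
            \<le> measure_pmf.prob (open_sets ?D w) {f. y \<in> A}
              + measure_pmf.prob (open_sets ?D w) (\<Union>a\<in>A. \<Union>b\<in>{b. E a b}. ?L b)"
          by (rule measure_Un_le) auto
        also have "\<dots> \<le> of_bool (y \<in> A) + (\<Sum>a\<in>A. \<Sum>b | E a b. R b)"
        proof (rule add_mono)
          show "measure_pmf.prob (open_sets ?D w) {f. y \<in> A} \<le> of_bool (y \<in> A)" by simp
          have "measure_pmf.prob (open_sets ?D w) (\<Union>a\<in>A. \<Union>b\<in>{b. E a b}. ?L b)
              \<le> (\<Sum>a\<in>A. measure_pmf.prob (open_sets ?D w) (\<Union>b\<in>{b. E a b}. ?L b))"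
            using \<C>(2)[OF AC] by (intro measure_pmf.finite_measure_subadditive_finite) auto
          also have "\<dots> \<le> (\<Sum>a\<in>A. \<Sum>b | E a b. measure_pmf.prob (open_sets ?D w) (?L b))"
            using nb by (intro sum_mono measure_pmf.finite_measure_subadditive_finite) auto
          also have "\<dots> \<le> (\<Sum>a\<in>A. \<Sum>b | E a b. R b)"
          proof (intro sum_mono)
            fix b
            have "measure_pmf.prob (open_sets ?D w) (?L b)
                = measure_pmf.prob (open_union ?D w) {S. linked E S b y}"
              unfolding open_union_def by (simp add: vimage_def)
            also have "\<dots> \<le> R b" using A psubset.prems by (intro psubset.IH) auto
            finally show "measure_pmf.prob (open_sets ?D w) (?L b) \<le> R b" .
          qed
          finally show "measure_pmf.prob (open_sets ?D w) (\<Union>a\<in>A. \<Union>b\<in>{b. E a b}. ?L b)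
              \<le> (\<Sum>a\<in>A. \<Sum>b | E a b. R b)" .
        qed
        finally show "measure_pmf.prob (open_sets ?D w) ?T \<le> of_bool (y \<in> A) + (\<Sum>a\<in>A. \<Sum>b | E a b. R b)" .
      qed (use w[OF AC] in auto)
      finally show ?thesis .
    qed
    have "measure_pmf.prob (open_union \<D> w) {S. linked E S x y}
        = measure_pmf.prob (open_sets \<D> w) {c. linked E (\<Union>{B\<in>\<D>. c B}) x y}"
      unfolding open_union_def by (simp add: vimage_def)
    also have "\<dots> \<le> measure_pmf.prob (open_sets \<D> w) (\<Union>A\<in>{A\<in>\<D>. x \<in> A}. Ev A)"
    proof (rule measure_pmf.finite_measure_mono)
      show "{c. linked E (\<Union>{B\<in>\<D>. c B}) x y} \<subseteq> (\<Union>A\<in>{A\<in>\<D>. x \<in> A}. Ev A)"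
      proof
        fix c assume "c \<in> {c. linked E (\<Union>{B\<in>\<D>. c B}) x y}"
        then obtain A where A: "A \<in> \<D>" "c A" "x \<in> A"
          "y \<in> A \<or> (\<exists>a\<in>A. \<exists>b. E a b \<and> linked E (\<Union>({B\<in>\<D>. c B} - {A})) b y)"
          using linked_Union_decompose[of E "{B\<in>\<D>. c B}" x y] by auto
        moreover have "{B\<in>\<D>. c B} - {A} = {B\<in>\<D> - {A}. c B}" by auto
        ultimately show "c \<in> (\<Union>A\<in>{A\<in>\<D>. x \<in> A}. Ev A)"
          unfolding Ev_def by (intro UN_I[of A]) auto
      qed
    qed simp
    also have "\<dots> \<le> (\<Sum>A | A \<in> \<D> \<and> x \<in> A. measure_pmf.prob (open_sets \<D> w) (Ev A))"
      using psubset.hyps by (intro measure_pmf.finite_measure_subadditive_finite) auto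
    also have "\<dots> \<le> (\<Sum>A | A \<in> \<D> \<and> x \<in> A. w A * (of_bool (y \<in> A) + (\<Sum>a\<in>A. \<Sum>b | E a b. R b)))"
      using Ev by (intro sum_mono) auto
    also have "\<dots> \<le> (\<Sum>A | A \<in> \<C> \<and> x \<in> A. w A * (of_bool (y \<in> A) + (\<Sum>a\<in>A. \<Sum>b | E a b. R b)))"
      using \<C>(1) psubset.prems w R
      by (intro sum_mono2) (auto intro!: mult_nonneg_nonneg add_nonneg_nonneg sum_nonneg)
    also have "\<dots> \<le> R x" by (rule super)
    finally show ?case .
  qed
  then show ?thesis using \<C>(1) by blast
qed

section \<open>Extension of finite-dimensional laws of random subsets\<close>

lemma sets_subset_space_local:
  assumes F: "finite F" "F \<subseteq> V"
  shows "{S \<in> Pow V. S \<inter> F \<in> \<G>} \<in> sets (subset_space V)"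
proof -
  have space: "space (subset_space V) = Pow V"
    unfolding subset_space_def by (rule space_measure_of) auto
  have [measurable]: "Measurable.pred (subset_space V) (\<lambda>S. x \<in> S)" if "x \<in> V" for x
  proof -
    have "{S \<in> Pow V. x \<in> S} \<in> sets (subset_space V)"
      using that unfolding subset_space_def by (subst sets_measure_of) (auto intro!: sigma_sets.Basic)
    then show ?thesis by (simp add: pred_def space)
  qed
  \<comment> \<open>Written as a finite union, over the admissible traces \<open>B\<close>, of
    finite intersections of generators and their complements.\<close>
  have "{S \<in> space (subset_space V). \<exists>B\<in>Pow F \<inter> \<G>. \<forall>x\<in>F. (x \<in> S) = (x \<in> B)} \<in> sets (subset_space V)"
    using F by (intro sets.sets_Collect_finite_Ex sets.sets_Collect_finite_All) auto
  also have "{S \<in> space (subset_space V). \<exists>B\<in>Pow F \<inter> \<G>. \<forall>x\<in>F. (x \<in> S) = (x \<in> B)}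
      = {S \<in> Pow V. S \<inter> F \<in> \<G>}"
  proof -
    have "(\<exists>B\<in>Pow F \<inter> \<G>. \<forall>x\<in>F. (x \<in> S) = (x \<in> B)) \<longleftrightarrow> S \<inter> F \<in> \<G>" for S
    proof
      assume "\<exists>B\<in>Pow F \<inter> \<G>. \<forall>x\<in>F. (x \<in> S) = (x \<in> B)"
      then obtain B where "B \<subseteq> F" "B \<in> \<G>" "\<forall>x\<in>F. (x \<in> S) = (x \<in> B)" by auto
      moreover from this have "S \<inter> F = B" by auto
      ultimately show "S \<inter> F \<in> \<G>" by simp
    qed (auto intro!: bexI[of _ "S \<inter> F"])
    then show ?thesis by (simp add: space)
  qed
  finally show ?thesis .
qed

text \<open>Kolmogorov extension. Subsets are encoded by real-valued indicator functions, because
  the projective limit is taken over Polish spaces.\<close>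

lemma random_subset_extension:
  fixes p :: "'a set \<Rightarrow> 'a set pmf"
  assumes supp: "\<And>F. finite F \<Longrightarrow> F \<subseteq> V \<Longrightarrow> set_pmf (p F) \<subseteq> Pow F"
    and cons: "\<And>J F. J \<subseteq> F \<Longrightarrow> finite F \<Longrightarrow> F \<subseteq> V \<Longrightarrow> map_pmf (\<lambda>S. S \<inter> J) (p F) = p J"
  obtains M where "prob_space M" "sets M = sets (subset_space V)"
    "\<And>F \<G>. finite F \<Longrightarrow> F \<subseteq> V \<Longrightarrow>
       measure M {S \<in> space M. S \<inter> F \<in> \<G>} = measure_pmf.prob (p F) \<G>"
proof -
  let ?f = "\<lambda>J S. restrict (indicator S :: 'a \<Rightarrow> real) J"
  define P where "P J = distr (measure_pmf (p J)) (PiM J (\<lambda>_. borel)) (?f J)" for J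
  have f: "?f J \<in> measure_pmf q \<rightarrow>\<^sub>M PiM J (\<lambda>_. borel)" for J and q :: "'a set pmf"
    by (auto simp: space_PiM)
  have restr: "P J = distr (P F) (PiM J (\<lambda>_. borel)) (\<lambda>f. restrict f J)"
    if JF: "J \<subseteq> F" "finite F" "F \<subseteq> V" for J F
  proof -
    have "distr (P F) (PiM J (\<lambda>_. borel)) (\<lambda>f. restrict f J)
        = distr (measure_pmf (p F)) (PiM J (\<lambda>_. borel)) (\<lambda>S. restrict (?f F S) J)"
      unfolding P_def using JF(1)
      by (subst distr_distr[OF _ f]) (auto simp: comp_def intro: measurable_restrict_subset)
    also have "(\<lambda>S. restrict (?f F S) J) = ?f J \<circ> (\<lambda>S. S \<inter> J)"
      using JF(1) by (auto simp: fun_eq_iff restrict_def indicator_def)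
    also have "distr (measure_pmf (p F)) (PiM J (\<lambda>_. borel)) \<dots> = P J"
      unfolding P_def using cons[OF JF, symmetric] f[of J "map_pmf _ _"]
      by (simp add: map_pmf_rep_eq distr_distr[symmetric] space_PiM)
    finally show "P J = distr (P F) (PiM J (\<lambda>_. borel)) (\<lambda>f. restrict f J)" ..
  qed
  have prob: "prob_space (P J)" for J
    unfolding P_def by (rule measure_pmf.prob_space_distr[OF f])
  interpret P: polish_projective V P
    using restr prob by (intro polish_projective.intro projective_family.intro)
  \<comment> \<open>The limit measure lives on all real functions on \<open>V\<close>; a coordinate
    other than 1 is read as absence of the vertex.\<close>
  define T :: "('a \<Rightarrow> real) \<Rightarrow> 'a set" where "T \<omega> = {x\<in>V. \<omega> x = 1}" for \<omega>
  define M where "M = distr P.lim (subset_space V) T"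
  have space: "space (subset_space V) = Pow V"
    unfolding subset_space_def by (rule space_measure_of) auto
  have T: "T \<in> P.lim \<rightarrow>\<^sub>M subset_space V"
    unfolding subset_space_def
  proof (rule measurable_measure_of)
    fix A assume "A \<in> {{S \<in> Pow V. x \<in> S} |x. x \<in> V}"
    then obtain x where x: "x \<in> V" and A: "A = {S \<in> Pow V. x \<in> S}" by auto
    have "T -` A \<inter> space P.lim = {\<omega> \<in> space (PiM V (\<lambda>_. borel)). \<omega> x = (1::real)}"
      using x by (auto simp: A T_def)
    also have "\<dots> \<in> sets (PiM V (\<lambda>_. borel))" using x by measurable
    finally show "T -` A \<inter> space P.lim \<in> sets P.lim" by simp
  qed (auto simp: T_def)
  have spM: "space M = Pow V" by (simp add: M_def space)
  show thesis
  proof (rule that)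
    show "prob_space M" unfolding M_def using T by (rule P.P.prob_space_distr)
    show "sets M = sets (subset_space V)" by (simp add: M_def)
    fix F \<G> assume F: "finite F" "F \<subseteq> V"
    define X where "X = {\<omega> \<in> space (PiM F (\<lambda>_. borel)). {x\<in>F. \<omega> x = (1::real)} \<in> \<G>}"
    have eq: "{x\<in>F. \<omega> x = (1::real)} \<in> \<G> \<longleftrightarrow> (\<exists>B\<in>Pow F \<inter> \<G>. \<forall>x\<in>F. (\<omega> x = 1) = (x \<in> B))" for \<omega>
    proof
      assume "\<exists>B\<in>Pow F \<inter> \<G>. \<forall>x\<in>F. (\<omega> x = 1) = (x \<in> B)"
      then obtain B where "B \<subseteq> F" "B \<in> \<G>" "\<forall>x\<in>F. (\<omega> x = 1) = (x \<in> B)" by auto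
      moreover from this have "{x\<in>F. \<omega> x = 1} = B" by auto
      ultimately show "{x\<in>F. \<omega> x = (1::real)} \<in> \<G>" by simp
    qed (auto intro!: bexI[of _ "{x\<in>F. \<omega> x = 1}"])
    have X: "X \<in> sets (PiM F (\<lambda>_. borel))"
      unfolding X_def eq using F(1)
      by (intro sets.sets_Collect_finite_Ex sets.sets_Collect_finite_All) auto
    have "measure M {S \<in> space M. S \<inter> F \<in> \<G>} = measure P.lim (T -` {S \<in> Pow V. S \<inter> F \<in> \<G>} \<inter> space P.lim)"
      unfolding spM unfolding M_def by (rule measure_distr[OF T sets_subset_space_local[OF F]])
    also have "T -` {S \<in> Pow V. S \<inter> F \<in> \<G>} \<inter> space P.lim = P.emb V F X"
    proof -
      have "T \<omega> \<inter> F = {x\<in>F. \<omega> x = 1}" for \<omega> using F by (auto simp: T_def)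
      moreover have "{x \<in> F. restrict \<omega> F x = 1} = {x\<in>F. \<omega> x = (1::real)}" for \<omega> by auto
      moreover have "T \<omega> \<subseteq> V" for \<omega> by (auto simp: T_def)
      ultimately show ?thesis by (auto simp: X_def prod_emb_def space_PiM)
    qed
    also have "measure P.lim (P.emb V F X) = measure (P F) X"
      using F X by (intro P.measure_lim_emb)
    also have "\<dots> = measure_pmf.prob (p F) (?f F -` X)"
      unfolding P_def using measure_distr[OF f X] by simp
    \<comment> \<open>The two events agree on subsets of \<open>F\<close>, which carry all of
      \<open>p F\<close>.\<close>
    also have "\<dots> = measure_pmf.prob (p F) \<G>"
    proof (rule measure_prob_cong_0)
      have *: "?f F S \<in> X \<longleftrightarrow> S \<in> \<G>" if "S \<subseteq> F" for S
      proof -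
        have "{x\<in>F. ?f F S x = 1} = S" using that by (auto simp: indicator_def split: if_splits)
        then show ?thesis by (simp add: X_def space_PiM)
      qed
      then show "pmf (p F) S = 0" if "S \<in> ?f F -` X - \<G>" for S
        using that supp[OF F] by (auto simp: pmf_eq_0_set_pmf)
      show "pmf (p F) S = 0" if "S \<in> \<G> - ?f F -` X" for S
        using that * supp[OF F] by (auto simp: pmf_eq_0_set_pmf)
    qed
    finally show "measure M {S \<in> space M. S \<inter> F \<in> \<G>} = measure_pmf.prob (p F) \<G>" .
  qed
qed

section \<open>Simple random walk\<close>

locale walk_graph =
  fixes V :: "'a set" and E :: "'a \<Rightarrow> 'a \<Rightarrow> bool"
  assumes graph: "graph V E"
    and infinite_V: "infinite V"
    and connected: "induced_connected E V"
    and locally_finite: "locally_finite V E"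
begin

section \<open>Neighbourhoods and averages over neighbours\<close>

abbreviation nbs :: "'a \<Rightarrow> 'a set" where "nbs x \<equiv> {y. E x y}"

lemma edge_sym: "E x y \<longleftrightarrow> E y x"
  using graph by (auto simp: graph_def)

lemma edge_in_V: "E x y \<Longrightarrow> x \<in> V" "E x y \<Longrightarrow> y \<in> V"
  using graph by (auto simp: graph_def)

lemma finite_nbs [simp]: "finite (nbs x)"
proof (cases "x \<in> V")
  case False
  then have "nbs x = {}" using edge_in_V by blast
  then show ?thesis by simp
qed (use locally_finite in \<open>auto simp: locally_finite_def\<close>)

lemma nbs_nonempty:
  assumes "x \<in> V" shows "nbs x \<noteq> {}"
proof -
  obtain y where y: "y \<in> V" "y \<noteq> x"
    using infinite_V by (metis finite.emptyI finite_insert finite_subset insertI1 subsetI)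
  then have "(x, y) \<in> {(a, b). a \<in> V \<and> b \<in> V \<and> E a b}\<^sup>*"
    using connected assms by (auto simp: induced_connected_def)
  then show ?thesis using y(2) by (auto elim: converse_rtranclE)
qed

lemma deg_pos: "x \<in> V \<Longrightarrow> 0 < deg E x"
  using nbs_nonempty[of x] by (auto simp: deg_def card_gt_0_iff)

lemma nbs_outside: "x \<notin> V \<Longrightarrow> nbs x = {}"
  using edge_in_V by blast

lemma average_const:
  fixes c :: real
  assumes "x \<in> V" shows "(\<Sum>y\<in>nbs x. c / real (deg E x)) = c"
proof -
  have "(\<Sum>y\<in>nbs x. c / real (deg E x)) = real (deg E x) * (c / real (deg E x))"
    by (simp add: deg_def)
  then show ?thesis using deg_pos[OF assms] by simp
qed

text \<open>The condition \<open>0 \<le> c\<close> covers vertices outside \<open>V\<close>, where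
  the average is an empty sum.\<close>

lemma average_le_const:
  fixes c :: real
  assumes "\<And>y. E x y \<Longrightarrow> f y \<le> c" "0 \<le> c"
  shows "(\<Sum>y\<in>nbs x. f y / real (deg E x)) \<le> c"
proof (cases "x \<in> V")
  case True
  have "(\<Sum>y\<in>nbs x. f y / real (deg E x)) \<le> (\<Sum>y\<in>nbs x. c / real (deg E x))"
    by (intro sum_mono divide_right_mono) (use assms in auto)
  then show ?thesis using average_const[OF True] by simp
qed (use assms nbs_outside in simp)

lemma average_mono:
  assumes "\<And>y. E x y \<Longrightarrow> f y \<le> (g y :: real)"
  shows "(\<Sum>y\<in>nbs x. f y / real (deg E x)) \<le> (\<Sum>y\<in>nbs x. g y / real (deg E x))"
  by (intro sum_mono divide_right_mono) (use assms in auto)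

section \<open>Hitting and escape probabilities\<close>

lemma hit_prob_nonneg: "0 \<le> hit_prob E K n x"
  by (induction n arbitrary: x) (auto intro!: sum_nonneg)

lemma hit_prob_le_1: "hit_prob E K n x \<le> 1"
proof (induction n arbitrary: x)
  case (Suc n)
  then show ?case unfolding hit_prob.simps by (intro average_le_const) auto
qed simp

lemma incseq_hit_prob: "incseq (\<lambda>n. hit_prob E K n x)"
proof -
  have "hit_prob E K n x \<le> hit_prob E K (Suc n) x" for n
  proof (induction n arbitrary: x)
    case 0
    show ?case using hit_prob_nonneg[of K "Suc 0"] by simp
  next
    case (Suc n)
    show ?case
      unfolding hit_prob.simps(2)[of E K "Suc n"] by (subst hit_prob.simps) (intro average_mono; use Suc in auto)
  qed
  then show ?thesis by (rule incseq_SucI)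
qed

lemma hit_prob_Un: "hit_prob E (K \<union> L) n x \<le> hit_prob E K n x + hit_prob E L n x"
proof (induction n arbitrary: x)
  case (Suc n)
  have "hit_prob E (K \<union> L) (Suc n) x \<le>
     (\<Sum>y\<in>nbs x. ((if y \<in> K then 1 else hit_prob E K n y)
        + (if y \<in> L then 1 else hit_prob E L n y)) / real (deg E x))"
    unfolding hit_prob.simps by (intro average_mono) (auto simp: hit_prob_nonneg Suc)
  then show ?case by (simp add: add_divide_distrib sum.distrib)
qed simp

lemma escape_prob_LIMSEQ: "(\<lambda>n. 1 - hit_prob E K n x) \<longlonglongrightarrow> escape_prob E K x"
  unfolding escape_prob_def
  by (intro tendsto_diff tendsto_const LIMSEQ_incseq_SUP incseq_hit_prob bdd_aboveI2[where M = 1])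
     (simp add: hit_prob_le_1)

lemma escape_prob_nonneg: "0 \<le> escape_prob E K x"
  by (rule LIMSEQ_le_const[OF escape_prob_LIMSEQ]) (use hit_prob_le_1 in auto)

lemma escape_prob_le_1: "escape_prob E K x \<le> 1"
  by (rule LIMSEQ_le_const2[OF escape_prob_LIMSEQ]) (use hit_prob_nonneg in auto)

section \<open>Transition probabilities\<close>

lemma trans_pow_nonneg: "0 \<le> trans_pow E n x y"
  by (induction n arbitrary: x) (auto intro!: sum_nonneg)

lemma trans_pow_le_1: "trans_pow E n x y \<le> 1"
proof (induction n arbitrary: x)
  case (Suc n)
  then show ?case unfolding trans_pow.simps by (intro average_le_const) auto
qed simp

text \<open>\<open>trans_pow\<close> recurses on the first step; running the walk backwards needs
  the recursion on the last one.\<close>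

lemma trans_pow_Suc_right:
  "trans_pow E (Suc n) x y = (\<Sum>z\<in>nbs y. trans_pow E n x z / real (deg E z))"
proof (induction n arbitrary: x)
  case 0
  have "(\<Sum>z\<in>nbs x. (if z = y then 1 else 0) / real (deg E x)) = (if E x y then 1 / real (deg E x) else 0)"
    by (simp add: if_distrib[of "\<lambda>t. t / _"] sum.delta cong: if_cong)
  moreover have "(\<Sum>z\<in>nbs y. (if x = z then 1 else 0) / real (deg E z)) = (if E y x then 1 / real (deg E x) else 0)"
    by (subst sum.cong[OF refl, of _ _ "\<lambda>z. if z = x then 1 / real (deg E x) else 0"]) auto
  ultimately show ?case using edge_sym[of x y] by simp
next
  case (Suc n)
  have "trans_pow E (Suc (Suc n)) x y
      = (\<Sum>w\<in>nbs x. \<Sum>z\<in>nbs y. trans_pow E n w z / real (deg E z) / real (deg E x))"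
    unfolding trans_pow.simps(2)[of E "Suc n"] Suc.IH by (simp add: sum_divide_distrib)
  also have "\<dots> = (\<Sum>z\<in>nbs y. \<Sum>w\<in>nbs x. trans_pow E n w z / real (deg E x) / real (deg E z))"
    by (subst sum.swap) (simp add: mult.commute)
  finally show ?case by (simp add: sum_divide_distrib)
qed

text \<open>The factor \<open>deg E x\<close> cancels the probability of the first step, the
  induction hypothesis turns the remaining steps around, and the recursion on the last step
  reassembles them.\<close>

lemma trans_pow_reversible:
  "x \<in> V \<Longrightarrow> y \<in> V \<Longrightarrow> real (deg E x) * trans_pow E n x y = real (deg E y) * trans_pow E n y x"
proof (induction n arbitrary: x)
  case (Suc n)
  have "real (deg E x) * trans_pow E (Suc n) x y = (\<Sum>z\<in>nbs x. trans_pow E n z y)"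
    using deg_pos[OF Suc.prems(1)] by (simp add: sum_distrib_left)
  also have "\<dots> = (\<Sum>z\<in>nbs x. real (deg E y) * (trans_pow E n y z / real (deg E z)))"
  proof (intro sum.cong refl)
    fix z assume "z \<in> nbs x"
    then have "z \<in> V" using edge_in_V by auto
    then show "trans_pow E n z y = real (deg E y) * (trans_pow E n y z / real (deg E z))"
      using Suc.IH[of z] Suc.prems deg_pos[of z] by (simp add: field_simps)
  qed
  also have "\<dots> = real (deg E y) * trans_pow E (Suc n) y x"
    by (subst trans_pow_Suc_right) (simp add: sum_distrib_left)
  finally show ?case .
qed simp

text \<open>A single term of the Chapman-Kolmogorov sum, which is all that the comparisons below
  use.\<close>

lemma trans_pow_mult_le:
  "trans_pow E m x z * trans_pow E n z y \<le> trans_pow E (m + n) x y"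
proof (induction m arbitrary: x)
  case (Suc m)
  have "trans_pow E (Suc m) x z * trans_pow E n z y
      = (\<Sum>w\<in>nbs x. (trans_pow E m w z * trans_pow E n z y) / real (deg E x))"
    by (simp add: sum_distrib_right)
  also have "\<dots> \<le> trans_pow E (Suc m + n) x y"
    unfolding add_Suc trans_pow.simps by (intro average_mono Suc)
  finally show ?case .
qed (simp add: trans_pow_nonneg)

text \<open>Used to find, in an infinite graph, a vertex that is out of reach for a prescribed
  time.\<close>

lemma finite_trans_pow_support: "finite {y. trans_pow E n x y \<noteq> 0}"
proof (induction n arbitrary: x)
  case (Suc n)
  have "{y. trans_pow E (Suc n) x y \<noteq> 0} \<subseteq> (\<Union>z\<in>nbs x. {y. trans_pow E n z y \<noteq> 0})"
  proof
    fix y assume "y \<in> {y. trans_pow E (Suc n) x y \<noteq> 0}"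
    then have "(\<Sum>z\<in>nbs x. trans_pow E n z y / real (deg E x)) \<noteq> 0" by simp
    then obtain z where "z \<in> nbs x" "trans_pow E n z y / real (deg E x) \<noteq> 0"
      by (rule sum.not_neutral_contains_not_neutral)
    then show "y \<in> (\<Union>z\<in>nbs x. {y. trans_pow E n z y \<noteq> 0})" by auto
  qed
  then show ?case by (rule finite_subset) (use Suc in auto)
qed simp

lemma trans_pow_positive:
  assumes "x \<in> V" "y \<in> V" shows "\<exists>k. 0 < trans_pow E k x y"
proof -
  have "(x, y) \<in> {(a, b). a \<in> V \<and> b \<in> V \<and> E a b}\<^sup>*"
    using connected assms by (auto simp: induced_connected_def)
  then show ?thesis
  proof (induction rule: converse_rtrancl_induct)
    case base
    show ?case by (rule exI[of _ 0]) simp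
  next
    case (step a b)
    then obtain k where k: "0 < trans_pow E k b y" by auto
    have "0 < trans_pow E (Suc k) a y"
      unfolding trans_pow.simps using step k deg_pos[of a]
      by (intro sum_pos2[of _ b]) (auto simp: trans_pow_nonneg)
    then show ?case by blast
  qed
qed

text \<open>Union bound over the time of the visit, which is at least 1.\<close>

lemma hit_prob_singleton_le: "hit_prob E {b} n x \<le> (\<Sum>m<n. trans_pow E (Suc m) x b)"
proof (induction n arbitrary: x)
  case (Suc n)
  have *: "(\<Sum>m<n. trans_pow E (Suc m) y b) \<le> (\<Sum>m<Suc n. trans_pow E m y b)" for y
    by (subst sum.lessThan_Suc_shift) (use trans_pow_nonneg[of 0] in simp)
  have "hit_prob E {b} (Suc n) x \<le> (\<Sum>y\<in>nbs x. (\<Sum>m<Suc n. trans_pow E m y b) / real (deg E x))"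
    unfolding hit_prob.simps
  proof (intro average_mono)
    fix y
    have "1 \<le> (\<Sum>m<Suc n. trans_pow E m b b)"
      by (subst sum.lessThan_Suc_shift) (simp add: sum_nonneg trans_pow_nonneg del: trans_pow.simps(2))
    then show "(if y \<in> {b} then 1 else hit_prob E {b} n y) \<le> (\<Sum>m<Suc n. trans_pow E m y b)"
      using order.trans[OF Suc.IH[of y] *] by auto
  qed
  also have "\<dots> = (\<Sum>m<Suc n. trans_pow E (Suc m) x b)"
    unfolding trans_pow.simps(2) sum_divide_distrib by (rule sum.swap)
  finally show ?case .
qed simp

section \<open>The Green function and capacities of one and two points\<close>

definition green :: "'a \<Rightarrow> 'a \<Rightarrow> real" where
  "green x y = (\<Sum>n. trans_pow E n x y)"

lemma cap_singleton: "cap E {a} = real (deg E a) * escape_prob E {a} a"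
  by (simp add: cap_def)

text \<open>A walk that avoids \<open>a\<close> but not \<open>{a, b}\<close> visits
  \<open>b\<close> at a positive time; the probability of this is at most the expected number of
  visits.\<close>

lemma escape_prob_insert_le:
  assumes "a \<noteq> b" and s: "summable (\<lambda>n. trans_pow E n a b)"
  shows "escape_prob E {a} a - escape_prob E {a, b} a \<le> green a b"
proof (rule LIMSEQ_le_const2[OF tendsto_diff[OF escape_prob_LIMSEQ escape_prob_LIMSEQ]])
  show "\<exists>N. \<forall>n\<ge>N. 1 - hit_prob E {a} n a - (1 - hit_prob E {a, b} n a) \<le> green a b"
  proof (intro exI allI impI)
    fix n
    have "hit_prob E {a, b} n a - hit_prob E {a} n a \<le> (\<Sum>m<n. trans_pow E (Suc m) a b)"
      using hit_prob_Un[of "{a}" "{b}" n a] hit_prob_singleton_le[of b n a] by (simp add: insert_commute)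
    also have "\<dots> \<le> (\<Sum>m<Suc n. trans_pow E m a b)"
      using assms(1) by (subst sum.lessThan_Suc_shift) simp
    also have "\<dots> \<le> green a b"
      unfolding green_def using s by (intro sum_le_suminf) (auto simp: trans_pow_nonneg)
    finally show "1 - hit_prob E {a} n a - (1 - hit_prob E {a, b} n a) \<le> green a b" by simp
  qed
qed

text \<open>Passing to \<open>{a, b}\<close> lowers the escape probability at both points, and
  reversibility gives the two losses the same bound, hence the factor 2. If \<open>a = b\<close>,
  the left side is \<open>cap E {a}\<close> and the visit at time 0 makes \<open>green a a\<close>
  at least 1.\<close>

lemma cap_two_point:
  assumes V: "a \<in> V" "b \<in> V" and s: "summable (\<lambda>n. trans_pow E n a b)"
  shows "cap E {a} + cap E {b} - cap E {a, b} \<le> 2 * real (deg E a) * green a b"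
proof (cases "a = b")
  case True
  have "1 \<le> green a a"
    unfolding green_def using sum_le_suminf[OF s, of "{0}"] True by (simp add: trans_pow_nonneg)
  then have "cap E {a} \<le> 2 * real (deg E a) * green a b"
    using True escape_prob_le_1[of "{a}" a] unfolding cap_singleton
    by (subst mult.commute[of 2], subst mult.assoc, intro mult_left_mono) auto
  then show ?thesis using True by simp
next
  case False
  have rev: "trans_pow E n b a = real (deg E a) / real (deg E b) * trans_pow E n a b" for n
    using trans_pow_reversible[OF V, of n] deg_pos[OF V(2)] by (simp add: field_simps)
  have s': "summable (\<lambda>n. trans_pow E n b a)"
    unfolding rev by (intro summable_mult s)
  have g: "real (deg E b) * green b a = real (deg E a) * green a b"
    unfolding green_def rev suminf_mult[OF s] using deg_pos[OF V(2)] by simp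
  have "cap E {a} + cap E {b} - cap E {a, b}
      = real (deg E a) * (escape_prob E {a} a - escape_prob E {a, b} a)
        + real (deg E b) * (escape_prob E {b} b - escape_prob E {b, a} b)"
    using False by (simp add: cap_def algebra_simps insert_commute)
  also have "\<dots> \<le> real (deg E a) * green a b + real (deg E b) * green b a"
    using False s s' by (intro add_mono mult_left_mono escape_prob_insert_le) auto
  also have "\<dots> = 2 * real (deg E a) * green a b" unfolding g by simp
  finally show ?thesis .
qed

section \<open>Decay of transition probabilities from the spectral radius\<close>

lemma return_bound:
  assumes V: "x \<in> V" "y \<in> V" and deg: "\<forall>x\<in>V. deg E x \<le> \<Delta>"
  shows "(trans_pow E n x y)\<^sup>2 \<le> real \<Delta> * trans_pow E (n + n) x x"
proof -
  \<comment> \<open>One of the two factors is turned around by reversibility at the cost of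
    \<Delta>; going to \<open>y\<close> and back is then a return in \<open>n + n\<close>
    steps.\<close>
  have "1 * trans_pow E n x y \<le> real (deg E x) * trans_pow E n x y"
    using deg_pos[OF V(1)] by (intro mult_right_mono) (auto simp: trans_pow_nonneg)
  also have "\<dots> = real (deg E y) * trans_pow E n y x" by (rule trans_pow_reversible[OF V])
  also have "\<dots> \<le> real \<Delta> * trans_pow E n y x"
    using deg V by (intro mult_right_mono) (auto simp: trans_pow_nonneg)
  finally have "(trans_pow E n x y)\<^sup>2 \<le> trans_pow E n x y * (real \<Delta> * trans_pow E n y x)"
    by (simp add: power2_eq_square mult_left_mono trans_pow_nonneg)
  also have "\<dots> \<le> real \<Delta> * trans_pow E (n + n) x x"
    using mult_left_mono[OF trans_pow_mult_le[of n x y n x], of "real \<Delta>"] by (simp add: ac_simps)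
  finally show ?thesis .
qed

lemma trans_pow_eventually_le:
  assumes "spectral_radius E x y < \<theta>"
  shows "eventually (\<lambda>n. trans_pow E n x y \<le> \<theta> ^ n) sequentially"
proof -
  let ?f = "\<lambda>n. ereal (root n (trans_pow E n x y))"
  have r: "0 \<le> root n (trans_pow E n x y)" "root n (trans_pow E n x y) \<le> 1" for n
    using trans_pow_nonneg[of n x y] trans_pow_le_1[of n x y] by (cases "n = 0"; simp)+
  \<comment> \<open>Confining the limsup to \<open>[0, 1]\<close> excludes the infinite values,
    which \<open>real_of_ereal\<close> would send to 0.\<close>
  have "limsup ?f \<le> 1"
    by (rule Limsup_bounded) (use r in \<open>auto simp: one_ereal_def\<close>)
  moreover have "0 \<le> limsup ?f"
    by (rule le_Limsup) (use r in auto)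
  ultimately have "limsup ?f < ereal \<theta>"
    using assms unfolding spectral_radius_def by (cases "limsup ?f") auto
  then have "eventually (\<lambda>n. ?f n < ereal \<theta>) sequentially"
    by (rule Limsup_lessD)
  then show ?thesis
    using eventually_gt_at_top[of 0]
  proof eventually_elim
    case (elim n)
    then have "trans_pow E n x y = root n (trans_pow E n x y) ^ n"
      using trans_pow_nonneg[of n x y] by simp
    also have "\<dots> \<le> \<theta> ^ n" using elim r by (intro power_mono) auto
    finally show ?case .
  qed
qed

text \<open>The bound is uniform in the endpoint: by reversibility, off-diagonal transition
  probabilities are controlled by return probabilities.\<close>

lemma trans_pow_uniformly_summable:
  assumes V: "x0 \<in> V" "y0 \<in> V" and deg: "\<forall>x\<in>V. deg E x \<le> \<Delta>"
    and \<beta>: "0 < \<beta>" "spectral_radius E x0 y0 < 1 / \<beta>"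
  obtains b where "summable b" "\<And>n y. y \<in> V \<Longrightarrow> \<beta> ^ n * trans_pow E n x0 y \<le> b n"
proof -
  obtain \<theta> where \<theta>: "max 0 (spectral_radius E x0 y0) < \<theta>" "\<theta> < 1 / \<beta>"
    using dense[of "max 0 (spectral_radius E x0 y0)" "1 / \<beta>"] \<beta> by auto
  then have \<theta>0: "0 < \<theta>" by auto
  \<comment> \<open>The decay is known only for the pair \<open>x0\<close>, \<open>y0\<close>.
    Appending \<open>k\<close> steps from \<open>x0\<close> to \<open>y0\<close> transfers it to
    returns at \<open>x0\<close>.\<close>
  obtain k where k: "0 < trans_pow E k x0 y0" using trans_pow_positive[OF V] by auto
  obtain N where N: "\<And>n. n \<ge> N \<Longrightarrow> trans_pow E n x0 y0 \<le> \<theta> ^ n"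
    using trans_pow_eventually_le[of x0 y0 \<theta>] \<theta> unfolding eventually_sequentially by auto
  \<comment> \<open>Chosen so that \<open>(C * \<theta> ^ n)\<^sup>2\<close> is the bound obtained
    below for the square of the transition probability.\<close>
  define C where "C = sqrt (real \<Delta> * \<theta> ^ k / trans_pow E k x0 y0)"
  have bound: "trans_pow E n x0 y \<le> C * \<theta> ^ n" if n: "n \<ge> N" and y: "y \<in> V" for n y
  proof -
    have "trans_pow E (n + n) x0 x0 * trans_pow E k x0 y0 \<le> \<theta> ^ (n + n + k)"
      using trans_pow_mult_le[of "n + n" x0 x0 k y0] N[of "n + n + k"] n by linarith
    then have "trans_pow E (n + n) x0 x0 \<le> \<theta> ^ (n + n + k) / trans_pow E k x0 y0"
      using k by (simp add: field_simps)
    then have "(trans_pow E n x0 y)\<^sup>2 \<le> real \<Delta> * (\<theta> ^ (n + n + k) / trans_pow E k x0 y0)"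
      using return_bound[OF V(1) y deg, of n] mult_left_mono[of _ _ "real \<Delta>"] by fastforce
    also have "\<dots> = (C * \<theta> ^ n)\<^sup>2"
      unfolding C_def power_mult_distrib using k \<theta>0 by (simp add: power_add power2_eq_square)
    finally show ?thesis
      by (rule power2_le_imp_le) (use k \<theta>0 in \<open>simp add: C_def\<close>)
  qed
  \<comment> \<open>Before \<open>N\<close> nothing better than the bound 1 on probabilities is
    available; finitely many terms do not affect summability.\<close>
  define b where "b n = (if n < N then \<beta> ^ n else C * (\<beta> * \<theta>) ^ n)" for n
  have "summable (\<lambda>n. C * (\<beta> * \<theta>) ^ n)"
    using \<beta> \<theta> \<theta>0 by (intro summable_mult summable_geometric) (auto simp: field_simps)
  then have "summable b"
    by (rule iffD1[OF summable_cong, rotated]) (auto simp: b_def eventually_sequentially intro!: exI[of _ N])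
  moreover have "\<beta> ^ n * trans_pow E n x0 y \<le> b n" if "y \<in> V" for n y
  proof (cases "n < N")
    case True
    have "\<beta> ^ n * trans_pow E n x0 y \<le> \<beta> ^ n * 1"
      using \<beta> by (intro mult_left_mono trans_pow_le_1) auto
    then show ?thesis using True by (simp add: b_def)
  next
    case False
    have "\<beta> ^ n * trans_pow E n x0 y \<le> \<beta> ^ n * (C * \<theta> ^ n)"
      using \<beta> False that by (intro mult_left_mono bound) auto
    then show ?thesis using False by (simp add: b_def power_mult_distrib ac_simps)
  qed
  ultimately show ?thesis using that by blast
qed

text \<open>Reaching \<open>x\<close> from \<open>x0\<close> in \<open>k\<close> steps compares the
  series at \<open>x\<close> with a shift of the series at \<open>x0\<close>.\<close>

lemma summable_trans_pow:
  assumes V: "x0 \<in> V" "x \<in> V" "y \<in> V" and \<beta>: "0 < \<beta>"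
    and s: "summable (\<lambda>n. \<beta> ^ n * trans_pow E n x0 y)"
  shows "summable (\<lambda>n. \<beta> ^ n * trans_pow E n x y)"
proof -
  obtain k where k: "0 < trans_pow E k x0 x" using trans_pow_positive V by blast
  let ?c = "1 / (\<beta> ^ k * trans_pow E k x0 x)"
  have "summable (\<lambda>n. ?c * (\<beta> ^ (n + k) * trans_pow E (n + k) x0 y))"
    using summable_ignore_initial_segment[OF s, of k] by (rule summable_mult)
  then show ?thesis
  proof (rule summable_comparison_test'[where N = 0])
    fix n
    have "trans_pow E k x0 x * trans_pow E n x y \<le> trans_pow E (n + k) x0 y"
      using trans_pow_mult_le[of k x0 x n y] by (simp add: add.commute)
    then have "\<beta> ^ n * trans_pow E n x y \<le> \<beta> ^ n * (trans_pow E (n + k) x0 y / trans_pow E k x0 x)"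
      using k \<beta> by (intro mult_left_mono) (auto simp: field_simps)
    also have "\<dots> = ?c * (\<beta> ^ (n + k) * trans_pow E (n + k) x0 y)"
      using \<beta> k by (simp add: power_add field_simps)
    finally show "norm (\<beta> ^ n * trans_pow E n x y) \<le> ?c * (\<beta> ^ (n + k) * trans_pow E (n + k) x0 y)"
      using \<beta> trans_pow_nonneg[of n x y] by simp
  qed
qed

section \<open>The resolvent of the walk and the domination of potentials\<close>

definition weighted_green :: "real \<Rightarrow> 'a \<Rightarrow> 'a \<Rightarrow> real" where
  "weighted_green \<beta> x y = (\<Sum>n. \<beta> ^ n * trans_pow E n x y)"

lemma weighted_green_nonneg:
  assumes "summable (\<lambda>n. \<beta> ^ n * trans_pow E n x y)" "0 < \<beta>"
  shows "0 \<le> weighted_green \<beta> x y"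
  unfolding weighted_green_def using assms by (intro suminf_nonneg) (auto simp: trans_pow_nonneg)

text \<open>The resolvent equation: time 0 is split off, and every later term is averaged over the
  first step.\<close>

lemma weighted_green_eq:
  assumes s: "\<And>x. x \<in> V \<Longrightarrow> summable (\<lambda>n. \<beta> ^ n * trans_pow E n x y)" and x: "x \<in> V"
  shows "weighted_green \<beta> x y
      = (if x = y then 1 else 0) + \<beta> * (\<Sum>z\<in>nbs x. weighted_green \<beta> z y / real (deg E x))"
proof -
  have "weighted_green \<beta> x y = \<beta> ^ 0 * trans_pow E 0 x y + (\<Sum>n. \<beta> ^ Suc n * trans_pow E (Suc n) x y)"
    unfolding weighted_green_def suminf_split_head[OF s[OF x]] by simp
  also have "(\<Sum>n. \<beta> ^ Suc n * trans_pow E (Suc n) x y)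
      = (\<Sum>n. \<Sum>z\<in>nbs x. \<beta> / real (deg E x) * (\<beta> ^ n * trans_pow E n z y))"
    by (simp add: sum_distrib_left ac_simps)
  also have "\<dots> = (\<Sum>z\<in>nbs x. \<Sum>n. \<beta> / real (deg E x) * (\<beta> ^ n * trans_pow E n z y))"
    using edge_in_V by (intro suminf_sum summable_mult s) auto
  also have "\<dots> = (\<Sum>z\<in>nbs x. \<beta> / real (deg E x) * weighted_green \<beta> z y)"
    unfolding weighted_green_def using edge_in_V by (intro sum.cong refl suminf_mult s) auto
  finally show ?thesis by (simp add: sum_distrib_left)
qed

text \<open>With \<open>P\<close> the averaging over neighbours, iterating \<open>super\<close>
  gives h \<ge> f + P f + ... + P^(N-1) f + P^N h, where the last term is nonnegative. Only the part
  of \<open>f\<close> on the finite set \<open>F\<close> is kept.\<close>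

lemma potential_le_supersolution:
  fixes f h :: "'a \<Rightarrow> real"
  assumes F: "finite F" and f: "\<And>x. x \<in> V \<Longrightarrow> 0 \<le> f x" "F \<subseteq> V" and h: "\<And>x. x \<in> V \<Longrightarrow> 0 \<le> h x"
    and super: "\<And>x. x \<in> V \<Longrightarrow> f x + (\<Sum>z\<in>nbs x. h z / real (deg E x)) \<le> h x"
    and x: "x \<in> V" and s: "\<And>a. a \<in> F \<Longrightarrow> summable (\<lambda>n. trans_pow E n x a)"
  shows "(\<Sum>a\<in>F. green x a * f a) \<le> h x"
proof -
  have partial: "(\<Sum>a\<in>F. (\<Sum>m<N. trans_pow E m x a) * f a) \<le> h x" if "x \<in> V" for N x
    using that
  proof (induction N arbitrary: x)
    case (Suc N)
    have "(\<Sum>a\<in>F. (\<Sum>m<Suc N. trans_pow E m x a) * f a)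
        = (\<Sum>a\<in>F. (if x = a then 1 else 0) * f a) + (\<Sum>a\<in>F. (\<Sum>m<N. trans_pow E (Suc m) x a) * f a)"
      unfolding sum.lessThan_Suc_shift by (simp add: distrib_right sum.distrib del: trans_pow.simps(2))
    also have "(\<Sum>a\<in>F. (if x = a then 1 else 0) * f a) \<le> f x"
      using F f(1)[OF Suc.prems] by (simp add: if_distrib[of "\<lambda>t. t * _"] cong: if_cong)
    also have "(\<Sum>a\<in>F. (\<Sum>m<N. trans_pow E (Suc m) x a) * f a)
        = (\<Sum>a\<in>F. \<Sum>m<N. \<Sum>z\<in>nbs x. trans_pow E m z a * f a / real (deg E x))"
      by (simp add: sum_distrib_right)
    also have "\<dots> = (\<Sum>a\<in>F. \<Sum>z\<in>nbs x. \<Sum>m<N. trans_pow E m z a * f a / real (deg E x))"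
      by (intro sum.cong refl sum.swap)
    also have "\<dots> = (\<Sum>z\<in>nbs x. \<Sum>a\<in>F. \<Sum>m<N. trans_pow E m z a * f a / real (deg E x))"
      by (rule sum.swap)
    also have "\<dots> = (\<Sum>z\<in>nbs x. (\<Sum>a\<in>F. (\<Sum>m<N. trans_pow E m z a) * f a) / real (deg E x))"
      by (simp add: sum_divide_distrib sum_distrib_right)
    also have "\<dots> \<le> (\<Sum>z\<in>nbs x. h z / real (deg E x))"
      using edge_in_V by (intro average_mono Suc.IH) auto
    finally show ?case using super[OF Suc.prems] by linarith
  qed (simp add: h)
  have "(\<lambda>N. \<Sum>a\<in>F. (\<Sum>m<N. trans_pow E m x a) * f a) \<longlonglongrightarrow> (\<Sum>a\<in>F. green x a * f a)"
    unfolding green_def by (intro tendsto_sum tendsto_mult_right summable_LIMSEQ s)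
  then show ?thesis by (rule LIMSEQ_le_const2) (use partial x in auto)
qed

end

section \<open>The trace measure of the capacity\<close>

text \<open>Cesaro means: the terms before \<open>N\<close> contribute a fixed total
  \<open>C\<close>, which the division by \<open>Suc n\<close> makes negligible.\<close>

lemma LIMSEQ_arithmetic_mean:
  fixes a :: "nat \<Rightarrow> real"
  assumes "a \<longlonglongrightarrow> l"
  shows "(\<lambda>n. (\<Sum>k\<le>n. a k) / real (Suc n)) \<longlonglongrightarrow> l"
proof (rule LIMSEQ_I)
  fix r :: real assume r: "0 < r"
  obtain N where N: "\<And>k. k \<ge> N \<Longrightarrow> \<bar>a k - l\<bar> < r / 2"
    using LIMSEQ_D[OF assms, of "r / 2"] r by auto
  define C where "C = (\<Sum>k<N. \<bar>a k - l\<bar>)"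
  have "C / real (Suc n) + r / 2 < r" if "n > nat \<lceil>2 * C / r\<rceil>" for n
  proof -
    have "2 * C / r < real (Suc n)" using that by linarith
    then show ?thesis using r by (simp add: field_simps)
  qed
  moreover have "\<bar>(\<Sum>k\<le>n. a k) / real (Suc n) - l\<bar> \<le> C / real (Suc n) + r / 2" for n
  proof -
    have "(\<Sum>k\<le>n. a k) / real (Suc n) - l = (\<Sum>k\<le>n. a k - l) / real (Suc n)"
      by (simp add: sum_subtractf diff_divide_distrib)
    moreover have "\<bar>\<Sum>k\<le>n. a k - l\<bar> \<le> (\<Sum>k\<le>n. (if k < N then \<bar>a k - l\<bar> else 0) + r / 2)"
    proof (rule order.trans[OF sum_abs], rule sum_mono)
      show "\<bar>a k - l\<bar> \<le> (if k < N then \<bar>a k - l\<bar> else 0) + r / 2" for k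
        using N[of k] r by (auto simp: not_less less_imp_le)
    qed
    moreover have "(\<Sum>k\<le>n. (if k < N then \<bar>a k - l\<bar> else 0)) \<le> C"
      unfolding C_def by (subst sum.If_cases) (auto intro!: sum_mono2)
    ultimately have "\<bar>(\<Sum>k\<le>n. a k) / real (Suc n) - l\<bar> \<le> (C + real (Suc n) * (r / 2)) / real (Suc n)"
      by (simp add: sum.distrib divide_right_mono)
    also have "\<dots> = C / real (Suc n) + r / 2"
      unfolding add_divide_distrib by (subst nonzero_mult_div_cancel_left) simp_all
    finally show ?thesis .
  qed
  ultimately have "\<bar>(\<Sum>k\<le>n. a k) / real (Suc n) - l\<bar> < r" if "n > nat \<lceil>2 * C / r\<rceil>" for n
    using that order.strict_trans1 by blast
  then show "\<exists>n0. \<forall>n\<ge>n0. norm ((\<Sum>k\<le>n. a k) / real (Suc n) - l) < r"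
    unfolding real_norm_def Suc_le_eq[symmetric] by blast
qed

text \<open>\<open>\<nu> A\<close> is the mass of the trajectories whose trace on \<open>F\<close> is exactly \<open>A\<close>.\<close>

definition trace_measure :: "'a set \<Rightarrow> ('a set \<Rightarrow> real) \<Rightarrow> ('a set \<Rightarrow> real) \<Rightarrow> bool" where
  "trace_measure F \<phi> \<nu> \<longleftrightarrow>
     (\<forall>A\<subseteq>F. 0 \<le> \<nu> A) \<and> (\<forall>K\<subseteq>F. \<phi> K = (\<Sum>A | A \<subseteq> F \<and> A \<inter> K \<noteq> {}. \<nu> A))"

lemma finite_subsets_with: "finite F \<Longrightarrow> finite {A. A \<subseteq> F \<and> P A}"
  by (rule finite_subset[of _ "Pow F"]) auto

text \<open>The nonempty subsets of \<open>B\<close> are the subsets of \<open>F\<close> that meet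
  \<open>F\<close> but not \<open>F - B\<close>. Through this formula \<phi> determines \<nu> on
  nonempty sets by induction on \<open>B\<close>.\<close>

lemma trace_measure_inside:
  assumes F: "finite F" and \<nu>: "trace_measure F \<phi> \<nu>" and B: "B \<subseteq> F"
  shows "(\<Sum>A | A \<subseteq> B \<and> A \<noteq> {}. \<nu> A) = \<phi> F - \<phi> (F - B)"
proof -
  have "\<phi> F = (\<Sum>A | A \<subseteq> F \<and> A \<inter> F \<noteq> {}. \<nu> A)" using \<nu> by (auto simp: trace_measure_def)
  also have "{A. A \<subseteq> F \<and> A \<inter> F \<noteq> {}} = {A. A \<subseteq> F \<and> A \<inter> (F - B) \<noteq> {}} \<union> {A. A \<subseteq> B \<and> A \<noteq> {}}"
    using B by auto
  also have "(\<Sum>A\<in>\<dots>. \<nu> A) = (\<Sum>A | A \<subseteq> F \<and> A \<inter> (F - B) \<noteq> {}. \<nu> A) + (\<Sum>A | A \<subseteq> B \<and> A \<noteq> {}. \<nu> A)"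
    using B by (intro sum.union_disjoint finite_subsets_with F finite_subset[OF B F]) auto
  also have "(\<Sum>A | A \<subseteq> F \<and> A \<inter> (F - B) \<noteq> {}. \<nu> A) = \<phi> (F - B)"
    using \<nu> by (auto simp: trace_measure_def)
  finally show ?thesis by simp
qed

text \<open>The mass of each nonempty set is a fixed linear combination of values of \<phi>, so
  convergence of the latter gives convergence of the masses.\<close>

lemma trace_measure_limit:
  assumes F: "finite F" and ex: "\<And>n. \<exists>\<nu>. trace_measure F (\<phi> n) \<nu>"
    and lim: "\<And>K. K \<subseteq> F \<Longrightarrow> (\<lambda>n. \<phi> n K) \<longlonglongrightarrow> \<psi> K"
  shows "\<exists>\<nu>. trace_measure F \<psi> \<nu>"
proof -
  have "\<forall>n. \<exists>\<nu>. trace_measure F (\<phi> n) \<nu>" using ex by blast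
  from choice[OF this] obtain \<nu> where \<nu>: "\<And>n. trace_measure F (\<phi> n) (\<nu> n)" by blast
  have conv: "B \<noteq> {} \<Longrightarrow> convergent (\<lambda>n. \<nu> n B)" if "B \<subseteq> F" for B
    using finite_subset[OF that F] that
  proof (induction B rule: finite_psubset_induct)
    case (psubset B)
    have "\<nu> n B = \<phi> n F - \<phi> n (F - B) - (\<Sum>A | A \<subset> B \<and> A \<noteq> {}. \<nu> n A)" for n
    proof -
      have "{A. A \<subseteq> B \<and> A \<noteq> {}} = insert B {A. A \<subset> B \<and> A \<noteq> {}}" using psubset.prems by auto
      moreover have "finite {A. A \<subset> B \<and> A \<noteq> {}}"
        using finite_subsets_with[OF psubset.hyps] by (simp add: psubset_eq conj_assoc)
      ultimately show ?thesis using trace_measure_inside[OF F \<nu>[of n] psubset.prems(2)] by simp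
    qed
    moreover have "convergent (\<lambda>n. \<Sum>A | A \<subset> B \<and> A \<noteq> {}. \<nu> n A)"
    proof (rule convergent_sum)
      fix A assume "A \<in> {A. A \<subset> B \<and> A \<noteq> {}}"
      then show "convergent (\<lambda>n. \<nu> n A)" using psubset.IH[of A] psubset.prems by blast
    qed
    then have "convergent (\<lambda>n. \<phi> n F - \<phi> n (F - B) - (\<Sum>A | A \<subset> B \<and> A \<noteq> {}. \<nu> n A))"
      by (intro convergent_diff convergentI[OF lim]) auto
    ultimately show ?case by simp
  qed
  \<comment> \<open>The values of \<phi> say nothing about the mass of the empty set, which need not
    converge; it is set to 0.\<close>
  define \<mu> where "\<mu> B = (if B = {} then 0 else lim (\<lambda>n. \<nu> n B))" for B
  have \<mu>: "(\<lambda>n. \<nu> n B) \<longlonglongrightarrow> \<mu> B" if "B \<subseteq> F" "B \<noteq> {}" for B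
    using conv[OF that] that(2) by (simp add: \<mu>_def convergent_LIMSEQ_iff)
  have "0 \<le> \<mu> B" if "B \<subseteq> F" for B
  proof (cases "B = {}")
    case False
    have "0 \<le> \<nu> n B" for n using \<nu>[of n] that by (simp add: trace_measure_def)
    then show ?thesis by (intro LIMSEQ_le_const[OF \<mu>[OF that False]]) blast
  qed (simp add: \<mu>_def)
  moreover have "\<psi> K = (\<Sum>A | A \<subseteq> F \<and> A \<inter> K \<noteq> {}. \<mu> A)" if K: "K \<subseteq> F" for K
  proof (rule LIMSEQ_unique[OF lim[OF K]])
    have "(\<lambda>n. \<Sum>A | A \<subseteq> F \<and> A \<inter> K \<noteq> {}. \<nu> n A) \<longlonglongrightarrow> (\<Sum>A | A \<subseteq> F \<and> A \<inter> K \<noteq> {}. \<mu> A)"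
      by (intro tendsto_sum \<mu>) auto
    moreover have "\<phi> n K = (\<Sum>A | A \<subseteq> F \<and> A \<inter> K \<noteq> {}. \<nu> n A)" for n
      using \<nu>[of n] K by (simp add: trace_measure_def)
    ultimately show "(\<lambda>n. \<phi> n K) \<longlonglongrightarrow> (\<Sum>A | A \<subseteq> F \<and> A \<inter> K \<noteq> {}. \<mu> A)"
      by simp
  qed
  ultimately have "trace_measure F \<psi> \<mu>" by (simp add: trace_measure_def)
  then show ?thesis by blast
qed

text \<open>Inclusion-exclusion, checked set by set after rewriting all masses as sums of indicators
  over \<open>Pow F\<close>.\<close>

lemma trace_measure_two_point:
  assumes F: "finite F" and \<nu>: "trace_measure F \<phi> \<nu>" and ab: "a \<in> F" "b \<in> F"
  shows "(\<Sum>A | A \<subseteq> F \<and> a \<in> A \<and> b \<in> A. \<nu> A) = \<phi> {a} + \<phi> {b} - \<phi> {a, b}"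
proof -
  have indicator_form: "(\<Sum>A | A \<subseteq> F \<and> P A. \<nu> A) = (\<Sum>A\<in>Pow F. \<nu> A * of_bool (P A))" for P
    using F by (intro sum.mono_neutral_cong_left) auto
  have \<phi>: "\<phi> K = (\<Sum>A\<in>Pow F. \<nu> A * of_bool (A \<inter> K \<noteq> {}))" if "K \<subseteq> F" for K
    unfolding indicator_form[symmetric] using \<nu> that by (simp add: trace_measure_def)
  have "\<phi> {a} + \<phi> {b} - \<phi> {a, b} = (\<Sum>A\<in>Pow F. \<nu> A * of_bool (A \<inter> {a} \<noteq> {})
      + \<nu> A * of_bool (A \<inter> {b} \<noteq> {}) - \<nu> A * of_bool (A \<inter> {a, b} \<noteq> {}))"
    using ab by (simp add: \<phi> sum.distrib sum_subtractf)
  also have "\<dots> = (\<Sum>A\<in>Pow F. \<nu> A * of_bool (a \<in> A \<and> b \<in> A))"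
    by (intro sum.cong refl) auto
  finally show ?thesis unfolding indicator_form ..
qed

section \<open>Finite walks under the stationary measure\<close>

context walk_graph
begin

text \<open>Only the set of visited vertices is recorded, time 0 included, since the trace on a
  finite set depends on nothing else.\<close>

primrec walk_range :: "nat \<Rightarrow> 'a \<Rightarrow> 'a set pmf" where
  "walk_range 0 x = return_pmf {x}"
| "walk_range (Suc n) x = bind_pmf (pmf_of_set (nbs x)) (\<lambda>y. map_pmf (insert x) (walk_range n y))"

text \<open>In contrast to \<open>hit_prob\<close>, a visit at time 0 counts.\<close>

definition hit_from :: "'a set \<Rightarrow> nat \<Rightarrow> 'a \<Rightarrow> real" where
  "hit_from K n x = (if x \<in> K then 1 else hit_prob E K n x)"

lemma hit_prob_Suc: "hit_prob E K (Suc n) x = (\<Sum>y\<in>nbs x. hit_from K n y / real (deg E x))"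
  by (simp add: hit_from_def)

lemma prob_walk_range:
  "x \<in> V \<Longrightarrow> measure_pmf.prob (walk_range n x) {A. A \<inter> K \<noteq> {}} = hit_from K n x"
proof (induction n arbitrary: x)
  case 0
  then show ?case by (simp add: hit_from_def measure_return_pmf)
next
  case (Suc n)
  \<comment> \<open>Expressed as a point mass of a Boolean distribution, so that the formula for
    \<open>pmf_bind\<close> applies.\<close>
  have hit: "measure_pmf.prob p {A. A \<inter> K \<noteq> {}} = pmf (map_pmf (\<lambda>A. A \<inter> K \<noteq> {}) p) True"
    for p :: "'a set pmf"
    by (simp add: pmf_map vimage_def)
  have "measure_pmf.prob (walk_range (Suc n) x) {A. A \<inter> K \<noteq> {}} =
     (\<Sum>y\<in>nbs x. pmf (map_pmf (\<lambda>A. insert x A \<inter> K \<noteq> {}) (walk_range n y)) True / real (deg E x))"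
    unfolding hit using nbs_nonempty[OF Suc.prems]
    by (simp add: map_bind_pmf pmf_bind pmf.map_comp o_def integral_pmf_of_set deg_def sum_divide_distrib)
  also have "\<dots> = hit_from K (Suc n) x"
  proof (cases "x \<in> K")
    case True
    then show ?thesis
      using average_const[OF Suc.prems, of 1] nbs_nonempty[OF Suc.prems] by (auto simp: hit_from_def map_pmf_const)
  next
    case False
    then have "(\<Sum>y\<in>nbs x. pmf (map_pmf (\<lambda>A. insert x A \<inter> K \<noteq> {}) (walk_range n y)) True / real (deg E x))
        = (\<Sum>y\<in>nbs x. hit_from K n y / real (deg E x))"
      using Suc.IH edge_in_V by (intro sum.cong refl) (auto simp flip: hit)
    then show ?thesis using False by (simp add: hit_prob_Suc[symmetric] hit_from_def)
  qed
  finally show ?case .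
qed

text \<open>The ball of radius \<open>n\<close> around \<open>F\<close>: walks of \<open>n\<close>
  steps that meet \<open>F\<close> start in it, so sums over starting points stay finite.\<close>

primrec thicken :: "nat \<Rightarrow> 'a set \<Rightarrow> 'a set" where
  "thicken 0 F = F"
| "thicken (Suc n) F = thicken n F \<union> (\<Union>x\<in>thicken n F. nbs x)"

lemma finite_thicken: "finite F \<Longrightarrow> finite (thicken n F)"
  by (induction n) auto

lemma thicken_in_V: "F \<subseteq> V \<Longrightarrow> thicken n F \<subseteq> V"
  by (induction n) (use edge_in_V in auto)

lemma incseq_thicken: "incseq (\<lambda>n. thicken n F)"
  by (rule incseq_SucI) auto

lemma subset_thicken: "F \<subseteq> thicken n F"
  using incseqD[OF incseq_thicken, of 0 n] by simp

lemma hit_from_outside_thicken: "y \<notin> thicken n F \<Longrightarrow> K \<subseteq> F \<Longrightarrow> hit_from K n y = 0"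
proof (induction n arbitrary: y)
  case (Suc n)
  then have "y \<notin> K" using subset_thicken[of F "Suc n"] by auto
  moreover have "hit_from K n z = 0" if "E y z" for z
    using Suc that edge_sym[of y z] by (intro Suc.IH) auto
  ultimately show ?case by (simp add: hit_from_def[of K "Suc n"] hit_prob_Suc del: hit_prob.simps)
qed (auto simp: hit_from_def)

text \<open>Prepending a step to the walk preserves the invariant measure \<open>deg\<close>, so it adds to the mass of
  walks hitting \<open>K\<close> exactly those that start in \<open>K\<close> and do not return.\<close>

lemma stationary_hitting:
  assumes F: "finite F" "F \<subseteq> V" and K: "K \<subseteq> F"
  shows "(\<Sum>x\<in>thicken n F. real (deg E x) * hit_from K n x)
       = (\<Sum>k\<le>n. \<Sum>y\<in>K. real (deg E y) * (1 - hit_prob E K k y))"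
proof (induction n)
  case 0
  have "(\<Sum>x\<in>F. real (deg E x) * hit_from K 0 x) = (\<Sum>x\<in>F. if x \<in> K then real (deg E x) else 0)"
    by (intro sum.cong) (auto simp: hit_from_def)
  also have "\<dots> = (\<Sum>x\<in>K. real (deg E x))"
    using F K by (simp add: sum.If_cases Int_absorb1)
  finally show ?case by simp
next
  case (Suc n)
  let ?B = "thicken n F" and ?C = "thicken (Suc n) F"
  have fin: "finite ?B" "finite ?C" using F finite_thicken by blast+
  have V: "?C \<subseteq> V" using F thicken_in_V by blast
  have KC: "K \<subseteq> ?C" using K subset_thicken[of F "Suc n"] by auto
  \<comment> \<open>Either \<open>K\<close> is hit at a positive time, or the walk starts in
    \<open>K\<close> and does not return.\<close>
  have "(\<Sum>x\<in>?C. real (deg E x) * hit_from K (Suc n) x)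
      = (\<Sum>x\<in>?C. real (deg E x) * hit_prob E K (Suc n) x
           + (if x \<in> K then real (deg E x) * (1 - hit_prob E K (Suc n) x) else 0))"
    by (intro sum.cong refl) (auto simp: hit_from_def algebra_simps simp del: hit_prob.simps)
  also have "\<dots> = (\<Sum>x\<in>?C. real (deg E x) * hit_prob E K (Suc n) x)
      + (\<Sum>y\<in>K. real (deg E y) * (1 - hit_prob E K (Suc n) y))"
    using fin KC by (simp add: sum.distrib sum.If_cases Int_absorb1 del: hit_prob.simps thicken.simps)
  \<comment> \<open>The degree cancels the step probabilities and leaves a sum over edges, which can
    be read from either end; ends \<open>y\<close> outside \<open>?B\<close> contribute 0.\<close>
  also have "(\<Sum>x\<in>?C. real (deg E x) * hit_prob E K (Suc n) x)
      = (\<Sum>x\<in>?C. \<Sum>y\<in>?B. if E x y then hit_from K n y else 0)"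
  proof (intro sum.cong refl)
    fix x assume "x \<in> ?C"
    then have "0 < deg E x" using V deg_pos by blast
    then have "real (deg E x) * hit_prob E K (Suc n) x = (\<Sum>y\<in>nbs x. hit_from K n y)"
      unfolding hit_prob_Suc sum_distrib_left by simp
    also have "\<dots> = (\<Sum>y\<in>nbs x \<inter> ?B. hit_from K n y)"
      using hit_from_outside_thicken[OF _ K] by (intro sum.mono_neutral_right) auto
    also have "\<dots> = (\<Sum>y\<in>?B. if E x y then hit_from K n y else 0)"
      using fin by (simp add: sum.If_cases Int_commute)
    finally show "real (deg E x) * hit_prob E K (Suc n) x = \<dots>" .
  qed
  also have "\<dots> = (\<Sum>y\<in>?B. \<Sum>x\<in>?C. if E x y then hit_from K n y else 0)"
    by (rule sum.swap)
  also have "\<dots> = (\<Sum>y\<in>?B. real (deg E y) * hit_from K n y)"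
  proof (intro sum.cong refl)
    fix y assume y: "y \<in> ?B"
    \<comment> \<open>The larger ball contains all neighbours of \<open>y\<close>, so the full
      degree appears.\<close>
    have "?C \<inter> {x. E x y} = nbs y" using y edge_sym by auto
    then show "(\<Sum>x\<in>?C. if E x y then hit_from K n y else 0) = real (deg E y) * hit_from K n y"
      using fin by (simp add: sum.If_cases deg_def del: thicken.simps)
  qed
  finally show ?case using Suc.IH by (simp del: hit_prob.simps thicken.simps)
qed

text \<open>For walks of \<open>n\<close> steps started from the measure \<open>deg\<close>, the
  mass of each trace divided by \<open>Suc n\<close> is a trace measure for
  \<open>?\<phi> n\<close>. By \<open>stationary_hitting\<close>, \<open>?\<phi> n K\<close> is a
  Cesaro mean of quantities tending to \<open>cap E K\<close>.\<close>

lemma trace_measure_cap: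
  assumes F: "finite F" "F \<subseteq> V"
  shows "\<exists>\<nu>. trace_measure F (cap E) \<nu>"
proof -
  let ?\<phi> = "\<lambda>n K. (\<Sum>x\<in>thicken n F. real (deg E x) * hit_from K n x) / real (Suc n)"
  let ?tr = "\<lambda>n x A. measure_pmf.prob (walk_range n x) {S. S \<inter> F = A}"
  let ?\<nu> = "\<lambda>n A. (\<Sum>x\<in>thicken n F. real (deg E x) * ?tr n x A) / real (Suc n)"
  have tr: "hit_from K n x = (\<Sum>A | A \<subseteq> F \<and> A \<inter> K \<noteq> {}. ?tr n x A)"
    if "K \<subseteq> F" "x \<in> V" for n K x
  proof -
    have "{A. A \<inter> K \<noteq> {}} = (\<Union>A\<in>{A. A \<subseteq> F \<and> A \<inter> K \<noteq> {}}. {S. S \<inter> F = A})"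
    proof (intro set_eqI)
      fix S
      have "S \<inter> F \<inter> K = S \<inter> K" using that(1) by blast
      then show "S \<in> {A. A \<inter> K \<noteq> {}} \<longleftrightarrow> S \<in> (\<Union>A\<in>{A. A \<subseteq> F \<and> A \<inter> K \<noteq> {}}. {S. S \<inter> F = A})"
        by simp
    qed
    then have "hit_from K n x = measure_pmf.prob (walk_range n x) \<dots>"
      using prob_walk_range[OF that(2), of n K] by simp
    also have "\<dots> = (\<Sum>A | A \<subseteq> F \<and> A \<inter> K \<noteq> {}. ?tr n x A)"
      using F by (intro measure_pmf.finite_measure_finite_Union)
        (auto simp: disjoint_family_on_def)
    finally show ?thesis .
  qed
  have tm: "trace_measure F (?\<phi> n) (?\<nu> n)" for n
    unfolding trace_measure_def
  proof (intro conjI allI impI)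
    fix K assume K: "K \<subseteq> F"
    have "(\<Sum>x\<in>thicken n F. real (deg E x) * hit_from K n x)
        = (\<Sum>x\<in>thicken n F. \<Sum>A | A \<subseteq> F \<and> A \<inter> K \<noteq> {}. real (deg E x) * ?tr n x A)"
      using tr[OF K] thicken_in_V[OF F(2), of n] by (intro sum.cong refl) (auto simp: sum_distrib_left)
    also have "\<dots> = (\<Sum>A | A \<subseteq> F \<and> A \<inter> K \<noteq> {}. \<Sum>x\<in>thicken n F. real (deg E x) * ?tr n x A)"
      by (rule sum.swap)
    finally show "?\<phi> n K = (\<Sum>A | A \<subseteq> F \<and> A \<inter> K \<noteq> {}. ?\<nu> n A)"
      by (simp add: sum_divide_distrib)
  next
    fix A
    show "0 \<le> ?\<nu> n A"
      by (intro divide_nonneg_nonneg sum_nonneg mult_nonneg_nonneg measure_nonneg of_nat_0_le_iff)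
  qed
  show ?thesis
  proof (rule trace_measure_limit[OF F(1), where \<phi> = ?\<phi>])
    show "\<exists>\<nu>. trace_measure F (?\<phi> n) \<nu>" for n
      by (rule exI[where x = "?\<nu> n"]) (rule tm)
    show "(\<lambda>n. ?\<phi> n K) \<longlonglongrightarrow> cap E K" if K: "K \<subseteq> F" for K
      unfolding stationary_hitting[OF F K] cap_def
      by (intro LIMSEQ_arithmetic_mean tendsto_sum tendsto_mult_left escape_prob_LIMSEQ)
  qed
qed

lemma Union_thicken:
  assumes "x \<in> V" shows "(\<Union>n. thicken n {x}) = V"
proof
  show "(\<Union>n. thicken n {x}) \<subseteq> V" using thicken_in_V assms by blast
  show "V \<subseteq> (\<Union>n. thicken n {x})"
  proof
    fix y assume "y \<in> V"
    then have "(x, y) \<in> {(a, b). a \<in> V \<and> b \<in> V \<and> E a b}\<^sup>*"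
      using connected assms by (auto simp: induced_connected_def)
    then show "y \<in> (\<Union>n. thicken n {x})"
    proof (induction rule: rtrancl_induct)
      case base
      show ?case by (rule UN_I[of 0]) auto
    next
      case (step y z)
      then obtain n where "y \<in> thicken n {x}" by blast
      then have "z \<in> thicken (Suc n) {x}" using step by auto
      then show ?case by blast
    qed
  qed
qed

end

section \<open>Connectivity of the interlacement set\<close>

text \<open>A path has finitely many vertices, so one member of the increasing sequence contains
  them all.\<close>

lemma linked_exhaustion:
  assumes T: "incseq T" "S \<subseteq> (\<Union>k. T k)" and l: "linked E S x y"
  shows "\<exists>k. linked E (S \<inter> T k) x y"
proof -
  have "x \<in> S" "(x, y) \<in> {(a, b). a \<in> S \<and> b \<in> S \<and> E a b}\<^sup>*" using l by (auto simp: linked_def)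
  from this(2) show ?thesis
  proof (induction rule: rtrancl_induct)
    case base
    obtain k where "x \<in> T k" using T(2) \<open>x \<in> S\<close> by blast
    then show ?case using \<open>x \<in> S\<close> by (auto simp: linked_def)
  next
    case (step y z)
    then obtain k where k: "linked E (S \<inter> T k) x y" by blast
    have yz: "y \<in> S" "z \<in> S" "E y z" using step.hyps by auto
    obtain m where m: "z \<in> T m" using T(2) yz by blast
    have "T k \<subseteq> T (max k m)" "T m \<subseteq> T (max k m)" using T(1) by (auto simp: incseq_def)
    then have "linked E (S \<inter> T (max k m)) x y" "z \<in> S \<inter> T (max k m)"
      using linked_mono[OF k, of "S \<inter> T (max k m)"] m yz by blast+
    then show ?case using linked_step yz by metis
  qed
qed

section \<open>Local laws, their extension, and the failure of connectivity\<close>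

context walk_graph
begin

text \<open>Chosen for each \<open>F\<close> separately, with no compatibility between different
  \<open>F\<close> built in; \<open>local_law_restrict\<close> obtains it for the laws.\<close>

definition trace_mass :: "'a set \<Rightarrow> 'a set \<Rightarrow> real" where
  "trace_mass F = (SOME \<nu>. trace_measure F (cap E) \<nu>)"

definition local_law :: "real \<Rightarrow> 'a set \<Rightarrow> 'a set pmf" where
  "local_law u F = open_union (Pow F) (\<lambda>A. u * trace_mass F A)"

lemma trace_mass:
  "finite F \<Longrightarrow> F \<subseteq> V \<Longrightarrow> trace_measure F (cap E) (trace_mass F)"
  unfolding trace_mass_def by (rule someI_ex[OF trace_measure_cap])

lemma trace_mass_nonneg:
  "finite F \<Longrightarrow> F \<subseteq> V \<Longrightarrow> A \<subseteq> F \<Longrightarrow> 0 \<le> trace_mass F A"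
  using trace_mass by (auto simp: trace_measure_def)

lemma set_pmf_local_law: "set_pmf (local_law u F) \<subseteq> Pow F"
  using set_pmf_open_union[of "Pow F"] by (simp add: local_law_def)

lemma local_law_avoid:
  assumes F: "finite F" "F \<subseteq> V" and u: "0 \<le> u" and K: "K \<subseteq> F"
  shows "measure_pmf.prob (local_law u F) {S. S \<inter> K = {}} = exp (- u * cap E K)"
proof -
  have "measure_pmf.prob (local_law u F) {S. S \<inter> K = {}}
      = exp (- (\<Sum>A | A \<subseteq> F \<and> A \<inter> K \<noteq> {}. u * trace_mass F A))"
    unfolding local_law_def
    by (subst prob_open_union_avoid) (use F u trace_mass_nonneg[OF F] in auto)
  also have "(\<Sum>A | A \<subseteq> F \<and> A \<inter> K \<noteq> {}. u * trace_mass F A) = u * cap E K"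
    using trace_mass[OF F] K by (simp add: trace_measure_def sum_distrib_left)
  finally show ?thesis by simp
qed

text \<open>Both laws have the avoidance probabilities given by the capacity, and these determine a
  law whatever trace masses were chosen.\<close>

lemma local_law_restrict:
  assumes J: "J \<subseteq> F" and F: "finite F" "F \<subseteq> V" and u: "0 \<le> u"
  shows "map_pmf (\<lambda>S. S \<inter> J) (local_law u F) = local_law u J"
proof (rule pmf_eqI_avoidance[of J])
  show "finite J" using J F finite_subset by blast
  show "set_pmf (local_law u J) \<subseteq> Pow J" by (rule set_pmf_local_law)
  fix K assume K: "K \<subseteq> J"
  then have "S \<inter> J \<inter> K = S \<inter> K" for S by blast
  then have "measure_pmf.prob (map_pmf (\<lambda>S. S \<inter> J) (local_law u F)) {S. S \<inter> K = {}}
      = measure_pmf.prob (local_law u F) {S. S \<inter> K = {}}"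
    by (simp add: vimage_def)
  also have "\<dots> = exp (- u * cap E K)" using F u J K by (intro local_law_avoid) auto
  also have "\<dots> = measure_pmf.prob (local_law u J) {S. S \<inter> K = {}}"
    using F u J K by (intro local_law_avoid[symmetric]) (auto dest: finite_subset)
  finally show "measure_pmf.prob (map_pmf (\<lambda>S. S \<inter> J) (local_law u F)) {S. S \<inter> K = {}} = \<dots>" .
qed auto

text \<open>The set defining \<open>u_c\<close> contains vacuously every level without a law, so existence is needed.\<close>

lemma interlacement_exists:
  assumes u: "0 \<le> u"
  obtains M where "interlacement_law V E u M"
    "\<And>F \<G>. finite F \<Longrightarrow> F \<subseteq> V \<Longrightarrow>
       measure M {S \<in> space M. S \<inter> F \<in> \<G>} = measure_pmf.prob (local_law u F) \<G>"
proof (rule random_subset_extension[of V "local_law u"])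
  show "set_pmf (local_law u F) \<subseteq> Pow F" for F by (rule set_pmf_local_law)
  show "map_pmf (\<lambda>S. S \<inter> J) (local_law u F) = local_law u J"
    if "J \<subseteq> F" "finite F" "F \<subseteq> V" for J F
    using that u by (rule local_law_restrict)
  fix M
  assume M: "prob_space M" "sets M = sets (subset_space V)"
    "\<And>F \<G>. finite F \<Longrightarrow> F \<subseteq> V \<Longrightarrow>
       measure M {S \<in> space M. S \<inter> F \<in> \<G>} = measure_pmf.prob (local_law u F) \<G>"
  have "interlacement_law V E u M"
    unfolding interlacement_law_def
  proof (intro conjI M(1,2) allI impI)
    fix K assume K: "K \<subseteq> V" "finite K"
    have "measure M {S \<in> space M. S \<inter> K = {}} = measure_pmf.prob (local_law u K) {S. S \<inter> K = {}}"
      using M(3)[OF K(2,1), of "{S. S \<inter> K = {}}"] by (simp add: Int_assoc)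
    then show "measure M {S \<in> space M. S \<inter> K = {}} = exp (- u * cap E K)"
      using local_law_avoid[OF K(2,1) u] by simp
  qed
  then show thesis using M(3) by (rule that)
qed

text \<open>Since \<open>H = \<Sum>\<^sub>n \<beta>\<^sup>n P\<^sup>n \<delta>\<^sub>y\<close> satisfies \<open>H = \<delta>\<^sub>y + \<beta> P H\<close>, it dominates the Green potential of
  \<open>\<delta>\<^sub>y + (\<beta> - 1) P H\<close>; this makes \<open>2u\<Delta> H\<close> a supersolution of the recursion over chains of trajectories.\<close>

lemma prob_linked_local_law:
  assumes deg: "\<forall>x\<in>V. deg E x \<le> \<Delta>" and u: "0 \<le> u" and \<beta>: "\<beta> = 1 + 2 * u * real \<Delta> ^ 2"
    and s: "\<And>x z. x \<in> V \<Longrightarrow> z \<in> V \<Longrightarrow> summable (\<lambda>n. \<beta> ^ n * trans_pow E n x z)"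
    and F: "finite F" "F \<subseteq> V" and V: "x \<in> V" "y \<in> V"
  shows "measure_pmf.prob (local_law u F) {S. linked E S x y}
       \<le> 2 * u * real \<Delta> * weighted_green \<beta> x y"
proof -
  define H where "H x = weighted_green \<beta> x y" for x
  \<comment> \<open>Set to 0 outside \<open>V\<close>, because \<open>prob_linked_le\<close> asks
    for a nonnegative bound at every point of the type.\<close>
  define R where "R x = (if x \<in> V then 2 * u * real \<Delta> * H x else 0)" for x
  define avg where "avg x = (\<Sum>z\<in>nbs x. H z / real (deg E x))" for x
  have \<beta>1: "1 \<le> \<beta>" using u by (simp add: \<beta>)
  have H: "0 \<le> H x" if "x \<in> V" for x
    unfolding H_def using that V s \<beta>1 by (intro weighted_green_nonneg) auto
  have R: "0 \<le> R x" for x using H u by (simp add: R_def)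
  have avg: "0 \<le> avg x" for x
    unfolding avg_def using H edge_in_V by (intro sum_nonneg divide_nonneg_nonneg) auto
  have s1: "summable (\<lambda>n. trans_pow E n x z)" if "x \<in> V" "z \<in> V" for x z
  proof (rule summable_comparison_test'[OF s[OF that], where N = 0])
    fix n
    have "1 * trans_pow E n x z \<le> \<beta> ^ n * trans_pow E n x z"
      using \<beta>1 by (intro mult_right_mono trans_pow_nonneg) simp
    then show "norm (trans_pow E n x z) \<le> \<beta> ^ n * trans_pow E n x z"
      using trans_pow_nonneg[of n x z] by simp
  qed
  have green: "0 \<le> green x z" if "x \<in> V" "z \<in> V" for x z
    unfolding green_def by (intro suminf_nonneg s1 that trans_pow_nonneg)
  \<comment> \<open>The contribution of a vertex \<open>a\<close> of the first set of a chain: the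
    chain ends there, or crosses an edge to some \<open>b\<close> and continues.\<close>
  define f where "f a = of_bool (a = y) + (\<Sum>b\<in>nbs a. R b)" for a
  define g where "g a = of_bool (a = y) + (\<beta> - 1) * avg a" for a
  have f0: "0 \<le> f a" for a using R by (simp add: f_def sum_nonneg)
  have g0: "0 \<le> g a" for a using \<beta>1 avg by (simp add: g_def)
  have fg: "f a \<le> g a" if a: "a \<in> V" for a
  proof -
    \<comment> \<open>One factor \<Delta> comes from \<open>R\<close>, the other bounds the degree
      of \<open>a\<close>; together with \<open>2 * u\<close> they make up
      \<open>\<beta> - 1\<close>.\<close>
    have "(\<Sum>b\<in>nbs a. R b) = real (deg E a) * (2 * u * real \<Delta> * avg a)"
      using deg_pos[OF a] edge_in_V by (simp add: R_def avg_def sum_distrib_left)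
    also have "\<dots> \<le> real \<Delta> * (2 * u * real \<Delta> * avg a)"
      using deg a u avg by (intro mult_right_mono) auto
    also have "\<dots> = (\<beta> - 1) * avg a" by (simp add: \<beta> power2_eq_square)
    finally show ?thesis by (simp add: f_def g_def)
  qed
  have super: "(\<Sum>A | A \<in> Pow F \<and> x \<in> A.
      u * trace_mass F A * (of_bool (y \<in> A) + (\<Sum>a\<in>A. \<Sum>b | E a b. R b))) \<le> R x" for x
  proof (cases "x \<in> F")
    case False
    then have "{A. A \<in> Pow F \<and> x \<in> A} = {}" by auto
    then show ?thesis using R by (simp only: sum.empty)
  next
    case x: True
    then have xV: "x \<in> V" using F by auto
    have "(\<Sum>A | A \<in> Pow F \<and> x \<in> A.
        u * trace_mass F A * (of_bool (y \<in> A) + (\<Sum>a\<in>A. \<Sum>b | E a b. R b)))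
      = (\<Sum>A | A \<in> Pow F \<and> x \<in> A. \<Sum>a\<in>F. u * f a * (if a \<in> A then trace_mass F A else 0))"
    proof (intro sum.cong refl)
      fix A assume "A \<in> {A. A \<in> Pow F \<and> x \<in> A}"
      then have A: "A \<subseteq> F" "finite A" using F(1) finite_subset by auto
      have "of_bool (y \<in> A) + (\<Sum>a\<in>A. \<Sum>b | E a b. R b) = (\<Sum>a\<in>A. f a)"
        using A by (simp add: f_def sum.distrib of_bool_def)
      also have "\<dots> = (\<Sum>a\<in>F. if a \<in> A then f a else 0)"
        using A F(1) by (simp add: sum.If_cases Int_absorb1)
      finally show "u * trace_mass F A * (of_bool (y \<in> A) + (\<Sum>a\<in>A. \<Sum>b | E a b. R b))
          = (\<Sum>a\<in>F. u * f a * (if a \<in> A then trace_mass F A else 0))"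
        by (auto simp: sum_distrib_left intro!: sum.cong)
    qed
    \<comment> \<open>After the exchange the inner sum is the mass of the sets containing both
      \<open>x\<close> and \<open>a\<close>, to which the two-point bound applies.\<close>
    also have "\<dots> = (\<Sum>a\<in>F. u * f a * (\<Sum>A | A \<in> Pow F \<and> x \<in> A. if a \<in> A then trace_mass F A else 0))"
      by (subst sum.swap) (simp only: sum_distrib_left)
    also have "\<dots> = (\<Sum>a\<in>F. u * f a * (cap E {x} + cap E {a} - cap E {x, a}))"
    proof (intro sum.cong refl arg_cong2[where f = "(*)"])
      fix a assume a: "a \<in> F"
      have "(\<Sum>A | A \<in> Pow F \<and> x \<in> A. if a \<in> A then trace_mass F A else 0)
          = (\<Sum>A | A \<subseteq> F \<and> x \<in> A \<and> a \<in> A. trace_mass F A)"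
        using F(1) by (intro sum.mono_neutral_cong_right finite_subsets_with) auto
      also have "\<dots> = cap E {x} + cap E {a} - cap E {x, a}"
        by (rule trace_measure_two_point[OF F(1) trace_mass[OF F] x a])
      finally show "(\<Sum>A | A \<in> Pow F \<and> x \<in> A. if a \<in> A then trace_mass F A else 0) = \<dots>" .
    qed
    also have "\<dots> \<le> (\<Sum>a\<in>F. u * g a * (2 * real \<Delta> * green x a))"
    proof (rule sum_mono)
      fix a assume a: "a \<in> F"
      then have aV: "a \<in> V" using F by auto
      have "cap E {x} + cap E {a} - cap E {x, a} \<le> 2 * real (deg E x) * green x a"
        by (rule cap_two_point[OF xV aV s1[OF xV aV]])
      also have "\<dots> \<le> 2 * real \<Delta> * green x a"
        using deg xV green[OF xV aV] by (intro mult_right_mono) auto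
      finally have cap: "cap E {x} + cap E {a} - cap E {x, a} \<le> 2 * real \<Delta> * green x a" .
      have "0 \<le> cap E {x} + cap E {a} - cap E {x, a}"
        unfolding trace_measure_two_point[OF F(1) trace_mass[OF F] x a, symmetric]
        using trace_mass_nonneg[OF F] by (auto intro: sum_nonneg)
      moreover have "0 \<le> u * f a" using u f0 by simp
      ultimately show "u * f a * (cap E {x} + cap E {a} - cap E {x, a})
          \<le> u * g a * (2 * real \<Delta> * green x a)"
        by (rule mult_mono'[OF mult_left_mono[OF fg[OF aV] u] cap, rotated])
    qed
    also have "\<dots> = 2 * u * real \<Delta> * (\<Sum>a\<in>F. green x a * g a)"
      by (simp add: sum_distrib_left ac_simps)
    also have "\<dots> \<le> 2 * u * real \<Delta> * H x"
    proof (intro mult_left_mono potential_le_supersolution F xV H g0)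
      fix z assume z: "z \<in> V"
      have "H z = of_bool (z = y) + \<beta> * avg z"
        unfolding H_def avg_def using weighted_green_eq[of \<beta> y, OF s z] V by (simp add: of_bool_def)
      then show "g z + (\<Sum>w\<in>nbs z. H w / real (deg E z)) \<le> H z"
        unfolding avg_def[symmetric] by (simp add: g_def algebra_simps)
    qed (use u F s1 xV in auto)
    finally show ?thesis using xV by (simp add: R_def)
  qed
  have "measure_pmf.prob (local_law u F) {S. linked E S x y} \<le> R x"
    unfolding local_law_def
    by (rule prob_linked_le)
       (use F R super u trace_mass_nonneg[OF F] finite_subset[OF _ F(1)] in auto)
  then show ?thesis using V by (simp add: R_def H_def)
qed

text \<open>Nonnegativity of the two-point mass makes the capacity subadditive, so the events of
  containing \<open>x\<close> and \<open>y\<close> are positively correlated.\<close>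

lemma local_law_two_vertices:
  assumes V: "x \<in> V" "y \<in> V" and u: "0 \<le> u"
    and c: "c \<le> cap E {x}" "c \<le> cap E {y}" "0 \<le> c"
  shows "(1 - exp (- u * c))\<^sup>2 \<le> measure_pmf.prob (local_law u {x, y}) {S. x \<in> S \<and> y \<in> S}"
proof -
  let ?p = "measure_pmf.prob (local_law u {x, y})"
  have F: "finite {x, y}" "{x, y} \<subseteq> V" using V by auto
  have av: "?p {S. S \<inter> K = {}} = exp (- u * cap E K)" if "K \<subseteq> {x, y}" for K
    by (rule local_law_avoid[OF F u that])
  have "0 \<le> (\<Sum>A | A \<subseteq> {x, y} \<and> x \<in> A \<and> y \<in> A. trace_mass {x, y} A)"
    using trace_mass_nonneg[OF F] by (auto intro: sum_nonneg)
  then have sub: "cap E {x, y} \<le> cap E {x} + cap E {y}"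
    using trace_measure_two_point[OF F(1) trace_mass[OF F], of x y] by simp
  have "exp (- u * cap E {x}) * exp (- u * cap E {y}) \<le> exp (- u * cap E {x, y})"
    unfolding exp_add[symmetric] using mult_left_mono[OF sub u] by (simp add: algebra_simps)
  moreover have "(1 - exp (- u * c)) * (1 - exp (- u * c))
      \<le> (1 - exp (- u * cap E {x})) * (1 - exp (- u * cap E {y}))"
    using c u by (intro mult_mono) (auto simp: mult_left_mono)
  moreover have "?p {S. x \<in> S \<and> y \<in> S}
      = 1 - exp (- u * cap E {x}) - exp (- u * cap E {y}) + exp (- u * cap E {x, y})"
  proof -
    let ?X = "{S. S \<inter> {x} = {}}" and ?Y = "{S. S \<inter> {y} = {}}"
    have "{S. x \<in> S \<and> y \<in> S} = space (local_law u {x, y}) - (?X \<union> ?Y)" by auto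
    then have "?p {S. x \<in> S \<and> y \<in> S} = 1 - ?p (?X \<union> ?Y)"
      using measure_pmf.prob_compl[of "?X \<union> ?Y" "local_law u {x, y}"] by simp
    also have "?p (?X \<union> ?Y) = ?p ?X + ?p ?Y - ?p (?X \<inter> ?Y)"
      by (rule measure_Un3) (auto simp: measure_pmf.fmeasurable_eq_sets)
    also have "?X \<inter> ?Y = {S. S \<inter> {x, y} = {}}" by auto
    finally show ?thesis using av[of "{x}"] av[of "{y}"] av[of "{x, y}"] by simp
  qed
  ultimately show ?thesis by (simp add: power2_eq_square algebra_simps)
qed

text \<open>The tail of the dominating series is small uniformly in \<open>y\<close>, and a vertex
  that cannot be reached in fewer than \<open>N\<close> steps has no earlier terms.\<close>

lemma weighted_green_vanishes:
  assumes b: "summable b" "\<And>n y. y \<in> V \<Longrightarrow> \<beta> ^ n * trans_pow E n x y \<le> b n"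
    and \<beta>: "0 < \<beta>" and \<epsilon>: "0 < \<epsilon>"
  shows "\<exists>y\<in>V. weighted_green \<beta> x y < \<epsilon>"
proof -
  obtain N where N: "norm (\<Sum>n. b (n + N)) < \<epsilon>"
    using suminf_exist_split[OF \<epsilon> b(1)] by blast
  have "finite (\<Union>n<N. {y. trans_pow E n x y \<noteq> 0})"
    by (intro finite_UN_I finite_lessThan finite_trans_pow_support)
  then obtain y where y: "y \<in> V" "y \<notin> (\<Union>n<N. {y. trans_pow E n x y \<noteq> 0})"
    using infinite_V by (meson finite_subset subsetI)
  let ?t = "\<lambda>n. \<beta> ^ n * trans_pow E n x y"
  have s: "summable ?t"
    by (rule summable_comparison_test'[OF b(1), where N = 0])
       (use b(2)[OF y(1)] \<beta> trans_pow_nonneg in simp)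
  have "weighted_green \<beta> x y = (\<Sum>n. ?t (n + N)) + (\<Sum>n<N. ?t n)"
    unfolding weighted_green_def by (rule suminf_split_initial_segment[OF s])
  also have "(\<Sum>n<N. ?t n) = 0" using y by (intro sum.neutral) auto
  also have "(\<Sum>n. ?t (n + N)) \<le> (\<Sum>n. b (n + N))"
    using b(2)[OF y(1)] b(1) s by (intro suminf_le summable_ignore_initial_segment) auto
  finally show ?thesis using N y(1) by (intro bexI[of _ y]) auto
qed

text \<open>The upper bound on \<open>u\<close> amounts to \<open>\<beta> < 1 / \<rho>\<close>,
  which makes linking to distant vertices unlikely, whereas the escape bound keeps the probability
  of containing two given vertices away from 0.\<close>

lemma interlacement_disconnected:
  assumes deg: "\<forall>x\<in>V. deg E x \<le> \<Delta>" and V: "x0 \<in> V" "y0 \<in> V"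
    and esc: "0 < Inf ((\<lambda>x. escape_prob E {x} x) ` V)"
    and u: "0 < u" "u < 1 / (2 * real \<Delta> ^ 2) * (1 / spectral_radius E x0 y0 - 1)"
  shows "\<exists>M. interlacement_law V E u M \<and> \<not> (AE S in M. induced_connected E S)"
proof -
  define \<beta> where "\<beta> = 1 + 2 * u * real \<Delta> ^ 2"
  define \<delta> where "\<delta> = Inf ((\<lambda>x. escape_prob E {x} x) ` V)"
  let ?\<rho> = "spectral_radius E x0 y0"
  have \<Delta>: "0 < real \<Delta>" using deg V deg_pos[OF V(1)] by fastforce
  have \<beta>1: "1 \<le> \<beta>" using u by (simp add: \<beta>_def)
  have "2 * u * real \<Delta> ^ 2 < 1 / ?\<rho> - 1"
    using u(2) \<Delta> by (simp add: field_simps)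
  then have b1: "\<beta> < 1 / ?\<rho>" by (simp add: \<beta>_def)
  \<comment> \<open>Positivity of the spectral radius comes for free: the inverse of 0 is 0, and a
    negative number has a negative inverse.\<close>
  then have "0 < 1 / ?\<rho>" using \<beta>1 by linarith
  then have "0 < ?\<rho>" by simp
  then have \<rho>: "?\<rho> < 1 / \<beta>" using b1 \<beta>1 by (simp add: field_simps)
  obtain b where b: "summable b" "\<And>n y. y \<in> V \<Longrightarrow> \<beta> ^ n * trans_pow E n x0 y \<le> b n"
    using trans_pow_uniformly_summable[OF V deg, of \<beta>] \<beta>1 \<rho> by auto
  have s0: "summable (\<lambda>n. \<beta> ^ n * trans_pow E n x0 y)" if "y \<in> V" for y
    by (rule summable_comparison_test'[OF b(1), where N = 0])
       (use b(2)[OF that] \<beta>1 trans_pow_nonneg in simp)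
  have s: "summable (\<lambda>n. \<beta> ^ n * trans_pow E n x y)" if "x \<in> V" "y \<in> V" for x y
    using summable_trans_pow[OF V(1) that _ s0[OF that(2)]] \<beta>1 by simp
  have cap: "\<delta> \<le> cap E {x}" if "x \<in> V" for x
  proof -
    have "\<delta> \<le> escape_prob E {x} x"
      unfolding \<delta>_def using that
      by (intro cInf_lower bdd_belowI2[where m = 0]) (auto simp: escape_prob_nonneg)
    also have "\<dots> = 1 * escape_prob E {x} x" by simp
    also have "\<dots> \<le> cap E {x}"
      unfolding cap_singleton using deg_pos[OF that]
      by (intro mult_right_mono escape_prob_nonneg) simp
    finally show ?thesis .
  qed
  define c where "c = (1 - exp (- u * \<delta>))\<^sup>2"
  have c: "0 < c" using u esc by (simp add: c_def \<delta>_def)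
  \<comment> \<open>So far away that the bound on linking \<open>x0\<close> to \<open>y\<close>
    falls below \<open>c\<close>, the lower bound for containing both.\<close>
  obtain y where y: "y \<in> V" "weighted_green \<beta> x0 y < c / (2 * u * real \<Delta>)"
    using weighted_green_vanishes[OF b, of "c / (2 * u * real \<Delta>)"] c u \<Delta> \<beta>1 by auto
  define r where "r = 2 * u * real \<Delta> * weighted_green \<beta> x0 y"
  have r: "r < c" using y(2) u \<Delta> by (simp add: r_def field_simps)
  obtain M where M: "interlacement_law V E u M"
    "\<And>F \<G>. finite F \<Longrightarrow> F \<subseteq> V \<Longrightarrow>
       measure M {S \<in> space M. S \<inter> F \<in> \<G>} = measure_pmf.prob (local_law u F) \<G>"
    using interlacement_exists[of u] u by auto
  interpret M: prob_space M using M(1) by (simp add: interlacement_law_def)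
  have setsM: "sets M = sets (subset_space V)" using M(1) by (simp add: interlacement_law_def)
  have spaceM: "space M = Pow V"
    using sets_eq_imp_space_eq[OF setsM] unfolding subset_space_def by (simp add: space_measure_of_conv)
  let ?T = "\<lambda>k. thicken k {x0}"
  have T: "finite (?T k)" "?T k \<subseteq> V" for k using V finite_thicken thicken_in_V by auto
  define G where "G = {S \<in> space M. S \<inter> {x0, y} \<in> {S. x0 \<in> S \<and> y \<in> S}}"
  \<comment> \<open>Linking inside a finite ball depends on finitely many vertices, so its
    probability is given by a local law; the balls exhaust \<open>V\<close>.\<close>
  define L where "L k = {S \<in> space M. S \<inter> ?T k \<in> {S. linked E S x0 y}}" for k
  have L_sets: "L k \<in> sets M" for k
    unfolding L_def spaceM setsM using T by (intro sets_subset_space_local)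
  have "measure M G = measure_pmf.prob (local_law u {x0, y}) {S. x0 \<in> S \<and> y \<in> S}"
    unfolding G_def using V y by (intro M(2)) auto
  moreover have "c \<le> \<dots>"
    unfolding c_def using V y u esc cap by (intro local_law_two_vertices) (auto simp: \<delta>_def)
  ultimately have "c \<le> measure M G" by simp
  moreover have "measure M (\<Union>k. L k) \<le> r"
  proof (rule LIMSEQ_le_const2[OF M.finite_Lim_measure_incseq])
    show "range L \<subseteq> sets M" using L_sets by auto
    show "incseq L"
    proof (rule incseq_SucI)
      fix k
      have "linked E (S \<inter> ?T (Suc k)) x0 y" if "linked E (S \<inter> ?T k) x0 y" for S
        using that by (rule linked_mono) auto
      then show "L k \<le> L (Suc k)" unfolding L_def by (intro Collect_mono) simp
    qed
    have "measure M (L k) \<le> r" for k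
      unfolding L_def M(2)[OF T] r_def
      using u s T V y by (intro prob_linked_local_law[OF deg _ \<beta>_def]) auto
    then show "\<exists>N. \<forall>n\<ge>N. measure M (L n) \<le> r" by blast
  qed
  \<comment> \<open>Almost sure connectedness would place \<open>G\<close>, up to a null set, inside
    the linking event, against \<open>r < c\<close>.\<close>
  moreover have "measure M G \<le> measure M (\<Union>k. L k)" if "AE S in M. induced_connected E S"
  proof (rule M.finite_measure_mono_AE)
    show "(\<Union>k. L k) \<in> sets M" using L_sets by auto
    show "AE S in M. S \<in> G \<longrightarrow> S \<in> (\<Union>k. L k)"
      using that
    proof eventually_elim
      case (elim S)
      show ?case
      proof
        assume S: "S \<in> G"
        then have "linked E S x0 y" using elim by (auto simp: G_def linked_def induced_connected_def)
        moreover have "S \<subseteq> (\<Union>k. ?T k)" using S Union_thicken[OF V(1)] by (auto simp: G_def spaceM)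
        ultimately obtain k where "linked E (S \<inter> ?T k) x0 y"
          using linked_exhaustion[OF incseq_thicken] by blast
        then show "S \<in> (\<Union>k. L k)" using S by (auto simp: L_def G_def)
      qed
    qed
  qed
  ultimately have "\<not> (AE S in M. induced_connected E S)" using r by linarith
  then show ?thesis using M(1) by blast
qed

end

theorem theorem6p3:
  fixes V :: "'a set" and E :: "'a \<Rightarrow> 'a \<Rightarrow> bool" and \<Delta> :: nat and x0 y0 :: 'a
  assumes "graph V E"
    and "infinite V"
    and "induced_connected E V"
    and "\<forall>x\<in>V. deg E x \<le> \<Delta>"
    and "locally_finite V E"
    and "kappa_V V E > 0"
    and "Inf ((\<lambda>x. escape_prob E {x} x) ` V) > 0"
    and "x0 \<in> V" and "y0 \<in> V"
  shows "u_c V E \<ge> ereal (1 / (2 * real \<Delta> ^ 2) * (1 / spectral_radius E x0 y0 - 1))"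
proof -
  interpret walk_graph V E using assms by unfold_locales
  show ?thesis
    unfolding u_c_def
  \<comment> \<open>Every admissible level is bounded below; this includes the case of no admissible
    level, where the infimum is infinite.\<close>
  proof (rule Inf_greatest, safe)
    fix u :: real
    assume u: "0 < u"
      and con: "\<forall>M. interlacement_law V E u M \<longrightarrow> (AE S in M. induced_connected E S)"
    have "\<not> u < 1 / (2 * real \<Delta> ^ 2) * (1 / spectral_radius E x0 y0 - 1)"
      using interlacement_disconnected[OF assms(4,8,9,7) u] con by blast
    then show "ereal (1 / (2 * real \<Delta> ^ 2) * (1 / spectral_radius E x0 y0 - 1)) \<le> ereal u"
      unfolding ereal_less_eq not_less .
  qed
qed

end
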